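(* Let $N\ge 2$ be an integer and, for $\beta\ge 0$ and $b\ge 0$, let $$\Phi_\beta(b)=b\frac{I_{N/2}(b)}{I_{N/2-1}(b)}+\log\left[\frac{A_N}{A_{N-1}}\frac{b^{N/2-1}}{B_N\pi I_{N/2-1}(b)}\right]-\frac{\beta}{2}\left(\frac{I_{N/2}(b)}{I_{N/2-1}(b)}\right)^2.$$ (a) If $\beta\le N$, then $\Phi_\beta$ is minimized over $[0,\infty)$ at $b=0$, the corresponding minimizing density is constant, and the set of canonical macrostates is $\mathcal{E}_\beta=\{\mu\}$. (b) If $\beta>N$, the minimizer $b$ of $\Phi_\beta$ over $[0,\infty)$ is the unique strictly positive solution of $b=\beta\frac{I_{N/2}(b)}{I_{N/2-1}(b)}$, and $\lim_{\beta\downarrow N}b=0$. The set of canonical macrostates is $\mathcal{E}_\beta=\{\nu_x\}_{x\in\mathbb{S}^{N-1}}$, where $\nu_x$ is the probability measure on $\mathbb{S}^{N-1}$ whose density with respect to $\mu$ is $y\mapsto g(\langle x,y\rangle)$ with $g(t)$ proportional to $e^{bt}$ (with this $b$).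
   Context: $\mu$ is the uniform probability measure on $\mathbb{S}^{N-1}\subset\mathbb{R}^N$, $M_1(\mathbb{S}^{N-1})$ the probability measures on $\mathbb{S}^{N-1}$, $H(\nu\mid\mu)$ the relative entropy. The canonical macrostates $\mathcal{E}_\beta$ are the minimizers over $\nu\in M_1(\mathbb{S}^{N-1})$ of $H(\nu\mid\mu)-\frac{\beta}{2}\left|\int x\,d\nu(x)\right|^2$ (equivalently the zeros of the rate function of the empirical spin distribution under the mean-field $O(N)$ Gibbs measure at inverse temperature $\beta$). $I_\nu$ is the modified Bessel function of the first kind; $A_N=2\pi^{N/2}/\Gamma(N/2)$; $B_N=\prod_{k=0}^{N/2-1}|2k-1|$ for $N$ even and $B_N=2^{(N-3)/2}(1)_{(N-3)/2}$ for $N$ odd, $(a)_m$ the Pochhammer symbol. *)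

theory Defs
  imports "HOL-Probability.Probability"
begin

text \<open>Modified Bessel function of the first kind, via its power series
  I_nu(x) = sum_m (x/2)^(2m+nu) / (m! Gamma(m+nu+1)), used for x >= 0, nu >= 0.
  The factor (x/2)^nu is written so that (x/2)^0 = 1 also at x = 0.\<close>
definition besselI :: "real \<Rightarrow> real \<Rightarrow> real" where
  "besselI \<nu> x = (\<Sum>m. (x / 2) ^ (2 * m) * (if \<nu> = 0 then 1 else (x / 2) powr \<nu>)
                          / (fact m * Gamma (real m + \<nu> + 1)))"

definition A_const :: "nat \<Rightarrow> real" where
  "A_const N = 2 * pi powr (real N / 2) / Gamma (real N / 2)"

definition B_const :: "nat \<Rightarrow> real" where
  "B_const N = (if even N then (\<Prod>k\<in>{0..<N div 2}. \<bar>2 * real k - 1\<bar>)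
                else 2 ^ ((N - 3) div 2) * pochhammer (1::real) ((N - 3) div 2))"

text \<open>Phi_beta(b); at b = 0 it is given by its continuous extension
  (b^(N/2-1)/I_(N/2-1)(b) -> 2^(N/2-1) Gamma(N/2), and I_(N/2)(0) = 0).\<close>
definition Phi :: "nat \<Rightarrow> real \<Rightarrow> real \<Rightarrow> real" where
  "Phi N \<beta> b =
    (let \<nu> = real N / 2 - 1; r = besselI (\<nu> + 1) b / besselI \<nu> b in
     if b = 0 then ln (A_const N / A_const (N - 1) * (2 powr \<nu> * Gamma (\<nu> + 1))
                        / (B_const N * pi))
     else b * r + ln (A_const N / A_const (N - 1) * b powr \<nu> / (B_const N * pi * besselI \<nu> b))
          - \<beta> / 2 * r ^ 2)"

definition bstar :: "nat \<Rightarrow> real \<Rightarrow> real" where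
  "bstar N \<beta> = (THE b. b > 0 \<and> b = \<beta> * besselI (real N / 2) b / besselI (real N / 2 - 1) b)"

text \<open>Uniform probability measure on the unit sphere S^(N-1) of R^N (cone measure:
  push-forward of the normalized Lebesgue measure on the unit ball under x |-> x/|x|).\<close>
definition unif_sphere :: "(real ^ 'n::finite) measure" where
  "unif_sphere = distr (uniform_measure lborel (ball 0 1)) (restrict_space borel (sphere 0 1))
     (\<lambda>x. if x = 0 then (SOME y. norm y = (1::real)) else x /\<^sub>R norm x)"

definition prob_on_sphere :: "(real ^ 'n::finite) measure \<Rightarrow> bool" where
  "prob_on_sphere \<nu> \<longleftrightarrow> prob_space \<nu> \<and> sets \<nu> = sets (unif_sphere :: (real ^ 'n) measure)"

definition rel_entropy :: "'a measure \<Rightarrow> 'a measure \<Rightarrow> ereal" where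
  "rel_entropy \<nu> \<mu> =
    (let f = (\<lambda>x. enn2real (RN_deriv \<mu> \<nu> x)) in
     if sets \<nu> = sets \<mu> \<and> absolutely_continuous \<mu> \<nu> \<and> integrable \<mu> (\<lambda>x. f x * ln (f x))
     then ereal (\<integral>x. f x * ln (f x) \<partial>\<mu>) else \<infinity>)"

definition free_energy :: "real \<Rightarrow> (real ^ 'n::finite) measure \<Rightarrow> ereal" where
  "free_energy \<beta> \<nu> = rel_entropy \<nu> unif_sphere - ereal (\<beta> / 2 * (norm (\<integral>x. x \<partial>\<nu>))\<^sup>2)"

definition macrostates :: "real \<Rightarrow> (real ^ 'n::finite) measure set" where
  "macrostates \<beta> = {\<nu>. prob_on_sphere \<nu> \<and>
      (\<forall>\<nu>' :: (real ^ 'n) measure. prob_on_sphere \<nu>' \<longrightarrow> free_energy \<beta> \<nu> \<le> free_energy \<beta> \<nu>')}"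

definition vmf :: "real \<Rightarrow> real ^ 'n::finite \<Rightarrow> (real ^ 'n) measure" where
  "vmf b x = density unif_sphere
     (\<lambda>y. ennreal (exp (b * (x \<bullet> y)) / (\<integral>z. exp (b * (x \<bullet> z)) \<partial>unif_sphere)))"

end

theory Submission
  imports Defs
begin

text \<open>Write \<open>a = N / 2\<close>, and let \<open>L b = log_mgf a b\<close> be the logarithm of the Laplace transform
  \<open>\<integral>z. exp (b * (x \<bullet> z)) \<partial>\<mu>\<close> of the uniform measure in a unit direction \<open>x\<close>. Comparing the two
  expansions of a Gaussian integral yields all moments of \<open>x \<bullet> z\<close>, so that
  \<open>exp (L b)\<close> is the hypergeometric series \<open>0F1(a; b\<^sup>2 / 4)\<close> and the quotient of Bessel functions in the
  statement is \<open>L' b = b * q b\<close>, where \<open>q\<close> decreases strictly from \<open>q 0 = 1 / N\<close>.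

  By the Gibbs variational principle \<open>H(\<nu> | \<mu>) \<ge> v \<bullet> m - L (norm v)\<close> for the mean \<open>m\<close> of \<open>\<nu>\<close>, with
  equality only for the exponentially tilted measure with parameter \<open>v\<close>. The choice \<open>v = \<beta> *\<^sub>R m\<close>
  bounds the free energy of \<open>\<nu>\<close> from below by \<open>G (\<beta> * norm m)\<close> with \<open>G b = b\<^sup>2 / (2 * \<beta>) - L b\<close>.
  As \<open>G' b = b * (1 / \<beta> - q b)\<close>, the function \<open>G\<close> is minimal exactly at \<open>0\<close> if \<open>\<beta> \<le> N\<close> and exactly at
  the positive solution of \<open>q b = 1 / \<beta>\<close> if \<open>\<beta> > N\<close>, and the tilted measures attain the
  bound. Convexity of \<open>L\<close> bounds \<open>\<Phi>\<close> from below by \<open>G\<close> in the same way.\<close>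

section \<open>The hypergeometric series behind the Bessel quotient\<close>

definition hyp0F1 :: "real \<Rightarrow> real \<Rightarrow> real" where
  "hyp0F1 a t = (\<Sum>m. t ^ m / (fact m * pochhammer a m))"

lemma pochhammer_ge_1: "a \<ge> (1::real) \<Longrightarrow> pochhammer a m \<ge> 1"
proof (induction m)
  case (Suc m)
  have "1 * 1 \<le> pochhammer a m * (a + real m)"
    using Suc by (intro mult_mono) auto
  then show ?case by (simp add: pochhammer_rec' mult.commute)
qed simp

lemma summable_hyp0F1:
  fixes a t :: real
  assumes "a \<ge> 1"
  shows "summable (\<lambda>m. t ^ m / (fact m * pochhammer a m))"
proof (rule summable_comparison_test'[OF summable_exp[of "\<bar>t\<bar>"], of 0])
  fix m :: nat
  have p: "pochhammer a m \<ge> 1" using assms by (rule pochhammer_ge_1)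
  have "\<bar>t\<bar> ^ m / (fact m * pochhammer a m) \<le> \<bar>t\<bar> ^ m / (fact m * 1)"
    using p by (intro divide_left_mono mult_left_mono) auto
  then show "norm (t ^ m / (fact m * pochhammer a m)) \<le> inverse (fact m) * \<bar>t\<bar> ^ m"
    using p by (simp add: abs_mult power_abs field_simps)
qed

lemma hyp0F1_sums:
  "a \<ge> 1 \<Longrightarrow> (\<lambda>m. t ^ m / (fact m * pochhammer a m)) sums hyp0F1 a t"
  unfolding hyp0F1_def by (rule summable_sums[OF summable_hyp0F1])

lemma hyp0F1_0 [simp]: "hyp0F1 a 0 = 1"
  using powser_zero[of "\<lambda>m. 1 / (fact m * pochhammer a m)"] by (simp add: hyp0F1_def)

lemma hyp0F1_ge_1:
  assumes "a \<ge> 1" "t \<ge> 0"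
  shows "hyp0F1 a t \<ge> 1"
proof -
  have "pochhammer a m \<ge> 0" for m using pochhammer_ge_1[OF assms(1), of m] by simp
  then have "sum (\<lambda>m. t ^ m / (fact m * pochhammer a m)) {..<1} \<le> hyp0F1 a t"
    unfolding hyp0F1_def using assms by (intro sum_le_suminf summable_hyp0F1) auto
  then show ?thesis by simp
qed

lemma hyp0F1_pos: "a \<ge> 1 \<Longrightarrow> t \<ge> 0 \<Longrightarrow> hyp0F1 a t > 0"
  using hyp0F1_ge_1[of a t] by simp

text \<open>Termwise differentiation: \<open>pochhammer a (Suc m) = a * pochhammer (a + 1) m\<close>
  turns the shifted coefficients into those with parameter \<open>a + 1\<close>, up to the factor
  \<open>1 / a\<close>.\<close>

lemma DERIV_hyp0F1:
  assumes "a \<ge> 1"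
  shows "(hyp0F1 a has_real_derivative hyp0F1 (a + 1) t / a) (at t)"
proof -
  define c where "c m = 1 / (fact m * pochhammer a m)" for m
  have "diffs c m = 1 / (fact m * pochhammer (a + 1) m) / a" for m
    using assms by (simp add: diffs_def c_def pochhammer_rec del: of_nat_Suc)
  then have d: "(\<Sum>m. diffs c m * t ^ m) = (\<Sum>m. t ^ m / (fact m * pochhammer (a + 1) m) / a)"
    by (simp add: mult.commute)
  have "((\<lambda>x. \<Sum>m. c m * x ^ m) has_real_derivative (\<Sum>m. diffs c m * t ^ m)) (at t)"
    by (rule termdiffs_strong_converges_everywhere)
       (use summable_hyp0F1[OF assms] in \<open>simp add: c_def mult.commute\<close>)
  also have "(\<lambda>x. \<Sum>m. c m * x ^ m) = hyp0F1 a"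
    by (simp add: c_def hyp0F1_def fun_eq_iff mult.commute)
  also have "(\<Sum>m. diffs c m * t ^ m) = hyp0F1 (a + 1) t / a"
    unfolding d hyp0F1_def using assms by (subst suminf_divide[OF summable_hyp0F1]) auto
  finally show ?thesis .
qed

text \<open>Termwise comparison: the weights \<open>c m * s ^ m * (l m - q)\<close> sum to zero and change sign
  once, at \<open>M\<close>, so that multiplying them by \<open>(t / s) ^ m\<close> instead of \<open>(t / s) ^ M\<close>
  only decreases the sum.\<close>
lemma powser_ratio_strict_decreasing:
  fixes c l :: "nat \<Rightarrow> real"
  assumes c: "\<And>m. c m > 0" and l: "\<And>m n. m < n \<Longrightarrow> l n < l m"
    and sC: "\<And>x. summable (\<lambda>m. c m * x ^ m)" and sA: "\<And>x. summable (\<lambda>m. l m * c m * x ^ m)"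
    and st: "0 \<le> s" "s < t"
  shows "(\<Sum>m. l m * c m * t ^ m) / (\<Sum>m. c m * t ^ m)
       < (\<Sum>m. l m * c m * s ^ m) / (\<Sum>m. c m * s ^ m)"
proof -
  have C: "(\<Sum>m. c m * x ^ m) > 0" if "x \<ge> 0" for x
    using c that by (intro suminf_pos2[OF sC, of _ 0]) (auto simp: less_imp_le)
  define q where "q = (\<Sum>m. l m * c m * s ^ m) / (\<Sum>m. c m * s ^ m)"
  have sD: "summable (\<lambda>m. c m * x ^ m * (l m - q))" for x
    using summable_diff[OF sA summable_mult[OF sC, of q]] by (simp add: algebra_simps)
  have D: "(\<Sum>m. c m * x ^ m * (l m - q)) = (\<Sum>m. l m * c m * x ^ m) - q * (\<Sum>m. c m * x ^ m)" for x
    using suminf_diff[OF sA summable_mult[OF sC, of q]] suminf_mult[OF sC, of q]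
    by (simp add: algebra_simps)
  have D0: "(\<Sum>m. c m * s ^ m * (l m - q)) = 0"
  proof -
    have "q * (\<Sum>m. c m * s ^ m) = (\<Sum>m. l m * c m * s ^ m)"
      using C[OF st(1)] by (simp add: q_def)
    then show ?thesis unfolding D by simp
  qed
  have "(\<Sum>m. c m * t ^ m * (l m - q)) < 0"
  \<comment> \<open>The factor \<open>(t / s) ^ M\<close> makes no sense at \<open>s = 0\<close>;
    there \<open>q\<close> is \<open>l 0\<close>, and every term of positive index is
    negative.\<close>
  proof (cases "s = 0")
    case True
    then have q: "q = l 0"
      using c[of 0] by (simp add: q_def powser_zero)
    have neg: "l m - q < 0" if "m > 0" for m using l[OF that] q by simp
    have "0 < (\<Sum>m. - (c m * t ^ m * (l m - q)))"
    proof (rule suminf_pos2[of _ 1])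
      fix m :: nat
      show "0 \<le> - (c m * t ^ m * (l m - q))"
        using neg[of m] c[of m] st q True by (cases "m = 0") (auto intro!: mult_nonneg_nonpos)
      show "0 < - (c 1 * t ^ 1 * (l 1 - q))"
        using neg[of 1] c[of 1] st by (auto intro!: mult_pos_neg)
    qed (intro summable_minus sD)
    then show ?thesis using sD by (simp add: suminf_minus)
  next
    case False
    with st have s: "s > 0" by simp
    \<comment> \<open>Otherwise all terms of the vanishing sum in \<open>D0\<close> would be
      positive.\<close>
    have "\<exists>m. l m \<le> q"
    proof (rule ccontr)
      assume "\<not> ?thesis"
      then have gt: "l m - q > 0" for m by (simp add: not_le)
      have "0 < (\<Sum>m. c m * s ^ m * (l m - q))"
        using c s gt by (intro suminf_pos sD mult_pos_pos) auto
      with D0 show False by simp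
    qed
    then obtain M where M: "l M \<le> q" "\<And>m. m < M \<Longrightarrow> l m > q"
      using exists_least_iff[of "\<lambda>m. l m \<le> q"] by (auto simp: not_le)
    define K where "K = t ^ M / s ^ M"
    have r: "t / s > 1" using s st by simp
    have less: "K * s ^ m > t ^ m" if "m < M" for m
    proof -
      have "(t / s) ^ m < (t / s) ^ M" using r that by (intro power_strict_increasing)
      then show ?thesis using s by (simp add: K_def power_divide field_simps)
    qed
    have more: "K * s ^ m \<le> t ^ m" if "m \<ge> M" for m
    proof -
      have "(t / s) ^ M \<le> (t / s) ^ m" using r that by (intro power_increasing) auto
      then show ?thesis using s by (simp add: K_def power_divide field_simps)
    qed
    have more': "K * s ^ Suc M < t ^ Suc M"
    proof -
      have "(t / s) ^ M < (t / s) ^ Suc M" using r by (intro power_strict_increasing) auto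
      then show ?thesis using s by (simp add: K_def power_divide field_simps)
    qed
    define f where "f m = K * (c m * s ^ m * (l m - q)) - c m * t ^ m * (l m - q)" for m
    have f: "f m = c m * ((K * s ^ m - t ^ m) * (l m - q))" for m
      by (simp add: f_def algebra_simps)
    have "0 < suminf f"
    proof (rule suminf_pos2[of _ "Suc M"])
      show "summable f" unfolding f_def by (intro summable_diff summable_mult sD)
      show "0 \<le> f m" for m
      proof (cases "m < M")
        case True
        then show ?thesis
          unfolding f using less[of m] M(2)[of m] c[of m] by (intro mult_nonneg_nonneg) auto
      next
        case False
        then have "l m \<le> q" using M(1) l[of M m] by (cases "m = M") auto
        then show ?thesis
          unfolding f using more[of m] False c[of m]
          by (intro mult_nonneg_nonneg mult_nonpos_nonpos) auto
      qed
      \<comment> \<open>Strictness comes from index \<open>Suc M\<close>: at \<open>M\<close> itself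
        the factor \<open>K * s ^ M - t ^ M\<close> is zero.\<close>
      show "0 < f (Suc M)"
        unfolding f using more' l[of M "Suc M"] M(1) c[of "Suc M"]
        by (intro mult_pos_pos mult_neg_neg) auto
    qed
    also have "suminf f = - (\<Sum>m. c m * t ^ m * (l m - q))"
      unfolding f_def
      using suminf_diff[OF summable_mult[OF sD] sD, of K s t] suminf_mult[OF sD, of K s] D0
      by simp
    finally show ?thesis by simp
  qed
  then have "(\<Sum>m. l m * c m * t ^ m) < q * (\<Sum>m. c m * t ^ m)"
    unfolding D by simp
  then show ?thesis
    using C[of t] st by (simp add: q_def[symmetric] pos_divide_less_eq)
qed

text \<open>For \<open>b > 0\<close> this is \<open>I_a(b) / (b * I_(a-1)(b))\<close>; with the
  factor \<open>b\<close> divided out it is even in \<open>b\<close> and also continuous at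
  0.\<close>

definition bessel_quot :: "real \<Rightarrow> real \<Rightarrow> real" where
  "bessel_quot a b = hyp0F1 (a + 1) (b\<^sup>2 / 4) / (2 * a * hyp0F1 a (b\<^sup>2 / 4))"

text \<open>Numerator and denominator are power series with coefficients \<open>l m * c m\<close>
  and \<open>c m\<close>, where \<open>l m = a / (a + m)\<close> decreases in \<open>m\<close>, as
  the comparison of quotients requires.\<close>

lemma bessel_quot_strict_decreasing:
  assumes a: "a \<ge> 1" and bb: "0 \<le> b" "b < b'"
  shows "bessel_quot a b' < bessel_quot a b"
proof -
  define c where "c m = 1 / (fact m * pochhammer a m)" for m
  define l where "l m = a / (a + real m)" for m
  have p: "pochhammer a m > 0" for m using pochhammer_ge_1[OF a, of m] by simp
  have lc: "l m * c m = 1 / (fact m * pochhammer (a + 1) m)" for m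
  proof -
    have "a * pochhammer (a + 1) m = (a + real m) * pochhammer a m"
      by (metis pochhammer_rec pochhammer_rec')
    then have "l m * c m = a / (fact m * (a * pochhammer (a + 1) m))"
      by (simp add: l_def c_def mult_ac)
    then show ?thesis using a by simp
  qed
  have sq: "b\<^sup>2 / 4 < b'\<^sup>2 / 4" using bb by (simp add: power_strict_mono)
  have "(\<Sum>m. l m * c m * (b'\<^sup>2 / 4) ^ m) / (\<Sum>m. c m * (b'\<^sup>2 / 4) ^ m)
      < (\<Sum>m. l m * c m * (b\<^sup>2 / 4) ^ m) / (\<Sum>m. c m * (b\<^sup>2 / 4) ^ m)"
  proof (rule powser_ratio_strict_decreasing)
    show "c m > 0" for m using p[of m] by (simp add: c_def)
    show "l n < l m" if "m < n" for m n
      using a that by (simp add: l_def divide_strict_left_mono)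
    show "summable (\<lambda>m. c m * x ^ m)" for x
      using summable_hyp0F1[OF a, of x] by (simp add: c_def)
    show "summable (\<lambda>m. l m * c m * x ^ m)" for x
      using summable_hyp0F1[of "a + 1" x] a by (simp add: lc)
  qed (use sq in auto)
  then have "hyp0F1 (a + 1) (b'\<^sup>2 / 4) / hyp0F1 a (b'\<^sup>2 / 4) < hyp0F1 (a + 1) (b\<^sup>2 / 4) / hyp0F1 a (b\<^sup>2 / 4)"
    by (simp add: lc) (simp add: c_def hyp0F1_def)
  then have "hyp0F1 (a + 1) (b'\<^sup>2 / 4) / hyp0F1 a (b'\<^sup>2 / 4) / (2 * a) < hyp0F1 (a + 1) (b\<^sup>2 / 4) / hyp0F1 a (b\<^sup>2 / 4) / (2 * a)"
    using a by (intro divide_strict_right_mono) auto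
  then show ?thesis by (simp add: bessel_quot_def mult.commute)
qed

lemma bessel_quot_0: "a \<ge> 1 \<Longrightarrow> bessel_quot a 0 = 1 / (2 * a)"
  by (simp add: bessel_quot_def)

lemma bessel_quot_pos: "a \<ge> 1 \<Longrightarrow> bessel_quot a b > 0"
  by (simp add: bessel_quot_def hyp0F1_pos)

lemma isCont_hyp0F1: "a \<ge> 1 \<Longrightarrow> isCont (hyp0F1 a) t"
  using DERIV_hyp0F1 DERIV_isCont by blast

lemma isCont_bessel_quot: "a \<ge> 1 \<Longrightarrow> isCont (bessel_quot a) b"
  unfolding bessel_quot_def
  using hyp0F1_pos[of a "b\<^sup>2 / 4"]
  by (intro continuous_intros isCont_o2[OF _ isCont_hyp0F1]) auto

lemma DERIV_ln_hyp0F1: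
  assumes "a \<ge> 1"
  shows "((\<lambda>b. ln (hyp0F1 a (b\<^sup>2 / 4))) has_real_derivative b * bessel_quot a b) (at b)"
proof -
  have pos: "hyp0F1 a (b\<^sup>2 / 4) > 0" using assms by (simp add: hyp0F1_pos)
  have "((\<lambda>b. hyp0F1 a (b\<^sup>2 / 4)) has_real_derivative hyp0F1 (a + 1) (b\<^sup>2 / 4) / a * (b / 2)) (at b)"
    by (rule DERIV_chain2[OF DERIV_hyp0F1[OF assms]]) (auto intro!: derivative_eq_intros)
  from DERIV_chain2[OF DERIV_ln this, OF pos] show ?thesis
    using assms pos by (simp add: bessel_quot_def field_simps)
qed

section \<open>Bessel functions and \<open>Phi\<close> in terms of the hypergeometric series\<close>

lemma Gamma_add_of_nat:
  fixes a :: real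
  assumes "a > 0"
  shows "Gamma (real m + a) = pochhammer a m * Gamma a"
proof -
  have "a \<notin> \<int>\<^sub>\<le>\<^sub>0" using assms by (auto elim!: nonpos_Ints_cases)
  moreover have "Gamma a > 0" using assms by simp
  ultimately show ?thesis using pochhammer_Gamma[of a m] by (simp add: add.commute)
qed

lemma besselI_conv_hyp0F1:
  assumes "\<nu> \<ge> 0"
  shows "besselI \<nu> b = (if \<nu> = 0 then 1 else (b / 2) powr \<nu>) / Gamma (\<nu> + 1) * hyp0F1 (\<nu> + 1) (b\<^sup>2 / 4)"
proof -
  let ?k = "(if \<nu> = 0 then 1 else (b / 2) powr \<nu>) / Gamma (\<nu> + 1)"
  have "(b / 2) ^ (2 * m) * (if \<nu> = 0 then 1 else (b / 2) powr \<nu>) / (fact m * Gamma (real m + \<nu> + 1))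
      = ?k * ((b\<^sup>2 / 4) ^ m / (fact m * pochhammer (\<nu> + 1) m))" for m
  proof -
    have "(b / 2) ^ (2 * m) = (b\<^sup>2 / 4) ^ m" by (simp add: power_mult power_divide)
    then show ?thesis
      using Gamma_add_of_nat[of "\<nu> + 1" m] assms by (simp add: add.assoc mult_ac)
  qed
  then show ?thesis
    unfolding besselI_def hyp0F1_def
    using suminf_mult[OF summable_hyp0F1[of "\<nu> + 1"], of ?k "b\<^sup>2 / 4"] assms by simp
qed

lemma besselI_quotient:
  assumes a: "a \<ge> 1" and b: "b \<ge> 0"
  shows "besselI a b / besselI (a - 1) b = b * bessel_quot a b"
proof (cases "b = 0")
  case True
  then show ?thesis using a by (simp add: besselI_conv_hyp0F1)
next
  case False
  with b have b: "b > 0" by simp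
  have G: "Gamma (a + 1) = a * Gamma a" "Gamma a \<noteq> 0"
    using a Gamma_add_of_nat[of a 1] less_imp_neq[OF Gamma_real_pos[of a]] by (simp_all add: add.commute)
  \<comment> \<open>\<open>P\<close> is the power in front of the series of
    \<open>besselI (a - 1)\<close>; one more factor \<open>b / 2\<close> gives the power for
    \<open>besselI a\<close>.\<close>
  define P where "P = (if a - 1 = 0 then 1 else (b / 2) powr (a - 1))"
  have P: "P > 0" "(b / 2) powr a = b / 2 * P"
    using b powr_add[of "b / 2" 1 "a - 1"] by (simp_all add: P_def)
  have "besselI (a - 1) b = P / Gamma a * hyp0F1 a (b\<^sup>2 / 4)"
    using besselI_conv_hyp0F1[of "a - 1" b] a by (simp add: P_def)
  moreover have "besselI a b = b / 2 * P / (a * Gamma a) * hyp0F1 (a + 1) (b\<^sup>2 / 4)"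
    using besselI_conv_hyp0F1[of a b] a G P by simp
  ultimately show ?thesis
    using a b G P hyp0F1_pos[of a "b\<^sup>2 / 4"] by (simp add: bessel_quot_def)
qed

text \<open>The constants are collected in \<open>Phi N \<beta> 0\<close>: for \<open>b > 0\<close>,
  \<open>b powr \<nu> / besselI \<nu> b\<close> is \<open>2 powr \<nu> * Gamma (\<nu> + 1)\<close>
  divided by the series, and the series is 1 at 0.\<close>

lemma Phi_eq:
  assumes N: "N \<ge> 2" and b: "b \<ge> 0"
  shows "Phi N \<beta> b = Phi N \<beta> 0 + b * (b * bessel_quot (real N / 2) b)
     - ln (hyp0F1 (real N / 2) (b\<^sup>2 / 4)) - \<beta> / 2 * (b * bessel_quot (real N / 2) b)\<^sup>2"
proof (cases "b = 0")
  case True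
  then show ?thesis by simp
next
  case False
  with b have b: "b > 0" by simp
  define \<nu> where "\<nu> = real N / 2 - 1"
  have \<nu>: "\<nu> \<ge> 0" "real N / 2 = \<nu> + 1" using N by (simp_all add: \<nu>_def)
  define D where "D = A_const N / A_const (N - 1) * (2 powr \<nu> * Gamma (\<nu> + 1)) / (B_const N * pi)"
  have pos: "A_const N > 0" "A_const (N - 1) > 0" "Gamma (\<nu> + 1) > 0" "hyp0F1 (\<nu> + 1) (b\<^sup>2 / 4) > 0"
    using N \<nu> by (simp_all add: A_const_def hyp0F1_pos)
  \<comment> \<open>The factors of \<open>B_const\<close> for even \<open>N\<close> are absolute
    values of odd integers, hence nonzero.\<close>
  have "\<bar>2 * real k - 1\<bar> > 0" for k
  proof -
    have "2 * int k \<noteq> 1" by presburger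
    then have "real_of_int (2 * int k) \<noteq> real_of_int 1" by (simp only: of_int_eq_iff not_False_eq_True)
    then show ?thesis by simp
  qed
  then have B: "B_const N > 0"
    unfolding B_const_def by (auto intro!: prod_pos mult_pos_pos pochhammer_pos)
  have D: "D > 0" unfolding D_def using pos B by (auto intro!: divide_pos_pos mult_pos_pos)
  have powr: "(b / 2) powr \<nu> = b powr \<nu> / 2 powr \<nu>" using b by (simp add: powr_divide)
  have "A_const N / A_const (N - 1) * b powr \<nu> / (B_const N * pi * besselI \<nu> b)
      = D / hyp0F1 (\<nu> + 1) (b\<^sup>2 / 4)"
    using b pos B \<nu>(1) by (cases "\<nu> = 0") (simp_all add: D_def besselI_conv_hyp0F1 powr)
  then have "ln (A_const N / A_const (N - 1) * b powr \<nu> / (B_const N * pi * besselI \<nu> b))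
      = ln D - ln (hyp0F1 (\<nu> + 1) (b\<^sup>2 / 4))"
    using D pos by (simp add: ln_div)
  moreover have "besselI (\<nu> + 1) b / besselI \<nu> b = b * bessel_quot (\<nu> + 1) b"
    using besselI_quotient[of "\<nu> + 1" b] \<nu> b by simp
  ultimately show ?thesis
    using b unfolding Phi_def Let_def \<nu>_def[symmetric] \<nu>(2) D_def by simp
qed

section \<open>Gaussian integrals and moments of directions\<close>

lemma nn_integral_lborel_affine:
  fixes f :: "'a::euclidean_space \<Rightarrow> ennreal"
  assumes [measurable]: "f \<in> borel_measurable borel" and "c \<noteq> 0"
  shows "(\<integral>\<^sup>+y. f y \<partial>lborel) = ennreal (\<bar>c\<bar> ^ DIM('a)) * (\<integral>\<^sup>+y. f (t + c *\<^sub>R y) \<partial>lborel)"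
  by (subst lborel_affine[OF assms(2), of t])
     (simp add: nn_integral_density nn_integral_distr nn_integral_cmult)

text \<open>This takes the place of polar coordinates. By scaling and homogeneity of degree 0, the
  ball of radius \<open>sqrt u\<close> has mass \<open>C * u powr (DIM('a) / 2)\<close>, and the
  density is the derivative of this mass.\<close>

lemma distributed_norm_sq_homogeneous:
  fixes h :: "'a::euclidean_space \<Rightarrow> real"
  assumes [measurable]: "h \<in> borel_measurable borel" and nn: "\<And>y. 0 \<le> h y"
    and hom: "\<And>c y. c > 0 \<Longrightarrow> h (c *\<^sub>R y) = h y"
    and C: "(\<integral>\<^sup>+y\<in>cball 0 1. ennreal (h y) \<partial>lborel) = ennreal C" "C \<ge> 0"
  shows "distributed (density lborel (\<lambda>y. ennreal (h y))) lborel (\<lambda>y. (norm y)\<^sup>2)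
    (\<lambda>u. ennreal (indicator {0..} u * (C * (real DIM('a) / 2) * u powr (real DIM('a) / 2 - 1))))"
proof (rule distributedI_borel_atMost[where g = "\<lambda>u. if u \<ge> 0 then C * u powr (real DIM('a) / 2) else 0"])
  let ?d = "real DIM('a) / 2"
  have d: "?d > 0" by simp
  show "AE u in lborel. 0 \<le> indicator {0..} u * (C * ?d * u powr (?d - 1))"
    using C by (auto simp: indicator_def)
  show "(\<lambda>y. (norm y)\<^sup>2) \<in> borel_measurable (density lborel (\<lambda>y. ennreal (h y)))"
    by simp
  fix u :: real
  show "(\<integral>\<^sup>+x. ennreal (indicator {0..} x * (C * ?d * x powr (?d - 1)) * indicator {..u} x) \<partial>lborel)
      = ennreal (if u \<ge> 0 then C * u powr ?d else 0)"
  proof (cases "u \<ge> 0")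
    case True
    have "((\<lambda>x. C * ?d * x powr (?d - 1)) has_integral C * ?d * (u powr (?d - 1 + 1) / (?d - 1 + 1))) {0..u}"
      using d True by (intro has_integral_mult_right has_integral_powr_from_0) auto
    moreover have "C * ?d * (u powr (?d - 1 + 1) / (?d - 1 + 1)) = C * u powr ?d" by simp
    ultimately have "((\<lambda>x. C * ?d * x powr (?d - 1)) has_integral C * u powr ?d) {0..u}" by simp
    from nn_integral_has_integral_lebesgue[OF _ this] C d
    have "(\<integral>\<^sup>+x. ennreal (indicator {0..u} x * (C * ?d * x powr (?d - 1))) \<partial>lborel) = ennreal (C * u powr ?d)"
      by simp
    also have "(\<lambda>x. ennreal (indicator {0..u} x * (C * ?d * x powr (?d - 1))))
       = (\<lambda>x. ennreal (indicator {0..} x * (C * ?d * x powr (?d - 1)) * indicator {..u} x))"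
      by (auto simp: indicator_def fun_eq_iff)
    finally show ?thesis using True by simp
  next
    case False
    then have "(\<lambda>x. ennreal (indicator {0..} x * (C * ?d * x powr (?d - 1)) * indicator {..u} x)) = (\<lambda>_. 0)"
      by (auto simp: indicator_def fun_eq_iff)
    then show ?thesis using False by simp
  qed
  show "emeasure (density lborel (\<lambda>y. ennreal (h y)))
          {x \<in> space (density lborel (\<lambda>y. ennreal (h y))). (norm x)\<^sup>2 \<le> u}
      = ennreal (if u \<ge> 0 then C * u powr ?d else 0)"
  proof (cases "u > 0")
    case True
    define r where "r = sqrt u"
    have r: "r > 0" "u = r\<^sup>2" using True by (auto simp: r_def)
    have le: "(norm x)\<^sup>2 \<le> u \<longleftrightarrow> x \<in> cball 0 r" for x :: 'a
      using r by (simp add: power_mono_iff)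
    have "emeasure (density lborel (\<lambda>y. ennreal (h y))) {x. (norm x)\<^sup>2 \<le> u}
        = (\<integral>\<^sup>+y\<in>cball 0 r. ennreal (h y) \<partial>lborel)"
      unfolding le Collect_mem_eq by (rule emeasure_density) auto
    also have "\<dots> = ennreal (\<bar>r\<bar> ^ DIM('a)) *
        (\<integral>\<^sup>+y. ennreal (h (0 + r *\<^sub>R y)) * indicator (cball 0 r) (0 + r *\<^sub>R y) \<partial>lborel)"
      using r by (intro nn_integral_lborel_affine) (measurable, auto)
    also have "(\<lambda>y. ennreal (h (0 + r *\<^sub>R y)) * indicator (cball 0 r) (0 + r *\<^sub>R y))
        = (\<lambda>y. ennreal (h y) * indicator (cball 0 1) (y::'a))"
      using r by (auto simp: fun_eq_iff hom indicator_def)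
    also have "ennreal (\<bar>r\<bar> ^ DIM('a)) * (\<integral>\<^sup>+y\<in>cball 0 1. ennreal (h y) \<partial>lborel) = ennreal (r ^ DIM('a) * C)"
      using r C by (simp add: ennreal_mult)
    also have "r ^ DIM('a) = u powr ?d"
      using r by (simp add: powr_powr powr_realpow[symmetric] flip: powr_numeral)
    finally show ?thesis using True by (simp add: mult.commute)
  next
    \<comment> \<open>For \<open>u \<le> 0\<close> at most the origin is left, which is a null
      set.\<close>
    case False
    then have "{x :: 'a. (norm x)\<^sup>2 \<le> u} \<subseteq> {0}"
      by (auto, metis linorder_not_less order_trans zero_less_norm_iff zero_less_power)
    then have "emeasure (density lborel (\<lambda>y. ennreal (h y))) {x. (norm x)\<^sup>2 \<le> u}
        \<le> emeasure (density lborel (\<lambda>y. ennreal (h y))) {0}"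
      by (intro emeasure_mono) auto
    also have "\<dots> = 0"
      by (subst emeasure_density) (auto simp: nn_integral_null_set)
    finally show ?thesis using False by simp
  qed
qed measurable

text \<open>In the variable \<open>u = (norm y)\<^sup>2\<close>, whose density is known from the
  previous lemma, the integral becomes Euler's integral for \<open>Gamma\<close>.\<close>

lemma nn_integral_homogeneous_gaussian:
  fixes h :: "'a::euclidean_space \<Rightarrow> real"
  assumes [measurable]: "h \<in> borel_measurable borel" and nn: "\<And>y. 0 \<le> h y"
    and hom: "\<And>c y. c > 0 \<Longrightarrow> h (c *\<^sub>R y) = h y"
    and C: "(\<integral>\<^sup>+y\<in>cball 0 1. ennreal (h y) \<partial>lborel) = ennreal C" "C \<ge> 0"
  shows "(\<integral>\<^sup>+y. ennreal (h y * norm y ^ (2 * k) * exp (- (norm y)\<^sup>2)) \<partial>lborel)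
    = ennreal (C * (real DIM('a) / 2) * Gamma (real DIM('a) / 2 + real k))"
proof -
  let ?d = "real DIM('a) / 2"
  let ?f = "\<lambda>u. indicator {0..} u * (C * ?d * u powr (?d - 1))"
  have d: "?d > 0" by simp
  have "(\<integral>\<^sup>+y. ennreal (h y * norm y ^ (2 * k) * exp (- (norm y)\<^sup>2)) \<partial>lborel)
      = (\<integral>\<^sup>+y. ennreal (((norm y)\<^sup>2) ^ k * exp (- (norm y)\<^sup>2)) \<partial>density lborel (\<lambda>y. ennreal (h y)))"
    by (subst nn_integral_density)
       (auto simp: power_mult mult.assoc nn simp flip: ennreal_mult' intro!: nn_integral_cong)
  also have "\<dots> = (\<integral>\<^sup>+u. ennreal (?f u) * ennreal (u ^ k * exp (- u)) \<partial>lborel)"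
    by (rule distributed_nn_integral[OF distributed_norm_sq_homogeneous[OF assms], symmetric]) auto
  also have "\<dots> = (\<integral>\<^sup>+u. ennreal (C * ?d) * ennreal (indicator {0..} u * u powr (?d + real k - 1) / exp u) \<partial>lborel)"
  \<comment> \<open>The exponent laws for \<open>powr\<close> are applied for \<open>u > 0\<close>,
    so the point 0 is removed as a null set; for negative \<open>u\<close> the indicators
    vanish.\<close>
  proof (rule nn_integral_cong_AE, rule AE_I'[of "{0}"])
    have "ennreal (?f u) * ennreal (u ^ k * exp (- u))
        = ennreal (C * ?d) * ennreal (indicator {0..} u * u powr (?d + real k - 1) / exp u)" if "u \<noteq> 0" for u
    proof (cases "u > 0")
      case True
      then have "u powr (?d + real k - 1) = u powr (?d - 1) * u ^ k"
        by (simp add: powr_realpow[symmetric] powr_add[symmetric] algebra_simps)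
      then show ?thesis
        using True C by (simp add: exp_minus field_simps flip: ennreal_mult')
    qed (use that in auto)
    then show "{u \<in> space lborel. ennreal (?f u) * ennreal (u ^ k * exp (- u))
        \<noteq> ennreal (C * ?d) * ennreal (indicator {0..} u * u powr (?d + real k - 1) / exp u)} \<subseteq> {0}"
      by auto
  qed auto
  also have "\<dots> = ennreal (C * ?d) * ennreal (Gamma (?d + real k))"
    by (subst Gamma_conv_nn_integral_real) (auto intro!: nn_integral_cmult add_pos_nonneg)
  also have "\<dots> = ennreal (C * ?d * Gamma (?d + real k))"
    using C d by (intro ennreal_mult[symmetric] mult_nonneg_nonneg less_imp_le[OF Gamma_real_pos] add_pos_nonneg) auto
  finally show ?thesis .
qed

section \<open>Even power series, uniqueness of coefficients and the Gaussian generating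
  function\<close>

lemma sums_even_iff:
  fixes f :: "nat \<Rightarrow> real"
  assumes "\<And>n. odd n \<Longrightarrow> f n = 0"
  shows "(\<lambda>k. f (2 * k)) sums c \<longleftrightarrow> f sums c"
proof (rule sums_mono_reindex)
  show "strict_mono (\<lambda>k::nat. 2 * k)" by (simp add: strict_mono_def)
  show "f n = 0" if "n \<notin> range (\<lambda>k. 2 * k)" for n
    using that assms by (metis evenE rangeI)
qed

lemma cosh_sums_even: "(\<lambda>k. (x::real) ^ (2 * k) / fact (2 * k)) sums cosh x"
  using sums_even_iff[of "\<lambda>n. if even n then x ^ n /\<^sub>R fact n else 0" "cosh x"] cosh_converges[of x]
  by (simp add: divide_inverse mult.commute)

text \<open>Strong induction on \<open>j\<close>: once the earlier coefficients vanish, division by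
  \<open>s ^ j\<close> leaves a series that is 0 for \<open>s \<noteq> 0\<close> and tends to
  \<open>c j\<close> as \<open>s\<close> tends to 0.\<close>

lemma powser_sums_zero_imp_coeff_zero:
  fixes c :: "nat \<Rightarrow> real"
  assumes "\<And>s. (\<lambda>n. c n * s ^ n) sums 0"
  shows "c j = 0"
proof (induction j rule: less_induct)
  case (less j)
  have "(\<lambda>n. c (n + j) * s ^ n) sums 0" if "s \<noteq> 0" for s
  proof -
    have "(\<lambda>n. c (n + j) * s ^ (n + j)) sums 0"
      using assms[of s] less by (subst sums_iff_shift) simp
    from sums_mult[OF this, of "1 / s ^ j"] show ?thesis
      using that by (simp add: power_add)
  qed
  then have "((\<lambda>_::real. 0) \<longlongrightarrow> c (0 + j)) (at 0)"
    by (intro powser_limit_0_strong[of 1 "\<lambda>n. c (n + j)"]) auto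
  then show ?case by (simp add: tendsto_const_iff)
qed

lemma even_powser_unique:
  fixes p q :: "nat \<Rightarrow> real"
  assumes p: "\<And>s. (\<lambda>k. p k * s ^ (2 * k)) sums f s" and q: "\<And>s. (\<lambda>k. q k * s ^ (2 * k)) sums f s"
  shows "p k = q k"
proof -
  define e where "e n = (if even n then p (n div 2) - q (n div 2) else 0)" for n
  have "(\<lambda>n. e n * s ^ n) sums 0" for s
    using sums_even_iff[of "\<lambda>n. e n * s ^ n" 0] sums_diff[OF p[of s] q[of s]]
    by (simp add: e_def left_diff_distrib)
  then have "e (2 * k) = 0" by (rule powser_sums_zero_imp_coeff_zero)
  then show ?thesis by (simp add: e_def)
qed

text \<open>Completing the square: translation by \<open>(s / 2) *\<^sub>R x\<close> absorbs the
  linear term and leaves the factor \<open>exp (s\<^sup>2 / 4)\<close>.\<close>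

lemma nn_integral_exp_inner_gaussian:
  fixes x :: "'a::euclidean_space"
  assumes "norm x = 1"
  shows "(\<integral>\<^sup>+y. ennreal (exp (s * (x \<bullet> y)) * exp (- (norm y)\<^sup>2)) \<partial>lborel)
    = ennreal (exp (s\<^sup>2 / 4)) * (\<integral>\<^sup>+y. ennreal (exp (- (norm (y::'a))\<^sup>2)) \<partial>lborel)"
proof -
  have eq: "s * (x \<bullet> ((s / 2) *\<^sub>R x + y)) - (norm ((s / 2) *\<^sub>R x + y))\<^sup>2 = s\<^sup>2 / 4 - (norm y)\<^sup>2" for y
  proof -
    have "x \<bullet> x = 1" using assms by (simp add: dot_square_norm)
    then show ?thesis
      unfolding power2_norm_eq_inner
      by (simp add: inner_add_left inner_add_right inner_commute[of y x] power2_eq_square distrib_left)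
  qed
  have "(\<integral>\<^sup>+y. ennreal (exp (s * (x \<bullet> y)) * exp (- (norm y)\<^sup>2)) \<partial>lborel)
      = (\<integral>\<^sup>+y. ennreal (exp (s * (x \<bullet> y) - (norm y)\<^sup>2)) \<partial>lborel)"
    by (simp add: mult_exp_exp)
  also have "\<dots> = (\<integral>\<^sup>+y. ennreal (exp (s\<^sup>2 / 4 - (norm (y::'a))\<^sup>2)) \<partial>lborel)"
    using nn_integral_lborel_affine[of "\<lambda>y. ennreal (exp (s * (x \<bullet> y) - (norm y)\<^sup>2))" 1 "(s / 2) *\<^sub>R x"]
    by (simp add: eq)
  also have "\<dots> = (\<integral>\<^sup>+y. ennreal (exp (s\<^sup>2 / 4)) * ennreal (exp (- (norm (y::'a))\<^sup>2)) \<partial>lborel)"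
  proof (rule nn_integral_cong)
    fix y :: 'a
    have "exp (s\<^sup>2 / 4 - (norm y)\<^sup>2) = exp (s\<^sup>2 / 4) * exp (- (norm y)\<^sup>2)"
      by (simp add: mult_exp_exp)
    then show "ennreal (exp (s\<^sup>2 / 4 - (norm y)\<^sup>2)) = ennreal (exp (s\<^sup>2 / 4)) * ennreal (exp (- (norm y)\<^sup>2))"
      by (simp only: ennreal_mult exp_ge_zero)
  qed
  also have "\<dots> = ennreal (exp (s\<^sup>2 / 4)) * (\<integral>\<^sup>+y. ennreal (exp (- (norm (y::'a))\<^sup>2)) \<partial>lborel)"
    by (rule nn_integral_cmult) auto
  finally show ?thesis .
qed

text \<open>The average over \<open>s\<close> and \<open>- s\<close>. Unlike that of
  \<open>exp\<close>, the series of \<open>cosh\<close> has only nonnegative terms, so that it can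
  be integrated term by term in \<open>ennreal\<close>.\<close>

lemma nn_integral_cosh_inner_gaussian:
  fixes x :: "'a::euclidean_space"
  assumes "norm x = 1"
  shows "(\<integral>\<^sup>+y. ennreal (cosh (s * (x \<bullet> y)) * exp (- (norm y)\<^sup>2)) \<partial>lborel)
    = ennreal (exp (s\<^sup>2 / 4)) * (\<integral>\<^sup>+y. ennreal (exp (- (norm (y::'a))\<^sup>2)) \<partial>lborel)"
proof -
  let ?E = "\<lambda>s y. ennreal (exp (s * (x \<bullet> y)) * exp (- (norm y)\<^sup>2))"
  let ?R = "ennreal (exp (s\<^sup>2 / 4)) * (\<integral>\<^sup>+y. ennreal (exp (- (norm (y::'a))\<^sup>2)) \<partial>lborel)"
  have "(\<integral>\<^sup>+y. ennreal (cosh (s * (x \<bullet> y)) * exp (- (norm y)\<^sup>2)) \<partial>lborel)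
      = (\<integral>\<^sup>+y. ennreal (1 / 2) * (?E s y + ?E (- s) y) \<partial>lborel)"
  proof (rule nn_integral_cong)
    fix y
    have "ennreal (1 / 2) * (?E s y + ?E (- s) y)
        = ennreal (1 / 2 * (exp (s * (x \<bullet> y)) * exp (- (norm y)\<^sup>2) + exp (- s * (x \<bullet> y)) * exp (- (norm y)\<^sup>2)))"
      by (subst ennreal_plus[symmetric], simp, simp, subst ennreal_mult[symmetric]) auto
    then show "ennreal (cosh (s * (x \<bullet> y)) * exp (- (norm y)\<^sup>2)) = ennreal (1 / 2) * (?E s y + ?E (- s) y)"
      by (simp add: cosh_def algebra_simps)
  qed
  also have "\<dots> = ennreal (1 / 2) * ((\<integral>\<^sup>+y. ?E s y \<partial>lborel) + (\<integral>\<^sup>+y. ?E (- s) y \<partial>lborel))"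
    by (simp add: nn_integral_cmult nn_integral_add)
  also have "\<dots> = ennreal (1 / 2) * (?R + ?R)"
    by (simp only: nn_integral_exp_inner_gaussian[OF assms] power2_minus)
  also have "\<dots> = ?R"
  proof -
    have "ennreal (1 / 2) * (z + z) = z" for z
    proof -
      have "ennreal (1 / 2) * (z + z) = (ennreal (1 / 2) + ennreal (1 / 2)) * z"
        by (simp only: distrib_left distrib_right)
      also have "ennreal (1 / 2) + ennreal (1 / 2) = 1"
        by (subst ennreal_plus[symmetric]) auto
      finally show ?thesis by simp
    qed
    then show ?thesis .
  qed
  finally show ?thesis .
qed

text \<open>Both sides of the Gaussian generating function are power series in \<open>s\<close>; their coefficients
  give the moments of the cone measure.\<close>
lemma nn_integral_cball_direction_power:
  fixes x :: "'a::euclidean_space"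
  assumes x: "norm x = 1"
  shows "(\<integral>\<^sup>+y\<in>cball 0 1. ennreal ((x \<bullet> (y /\<^sub>R norm y)) ^ (2 * k)) \<partial>lborel)
    = ennreal (fact (2 * k) / (4 ^ k * fact k * pochhammer (real DIM('a) / 2) k))
      * emeasure lborel (cball (0::'a) 1)"
proof -
  let ?d = "real DIM('a) / 2"
  have d: "?d > 0" by simp
  \<comment> \<open>\<open>h k\<close> depends only on the direction of \<open>y\<close>, so the
    lemma on homogeneous functions applies; \<open>h 0\<close> is constantly 1, so its integral is
    the volume of the ball.\<close>
  define h where "h k y = (x \<bullet> (y /\<^sub>R norm y)) ^ (2 * k)" for k and y :: 'a
  have [measurable]: "h k \<in> borel_measurable borel" for k
    unfolding h_def by measurable
  have h_nn: "0 \<le> h k y" for k y by (simp add: h_def)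
  have h_le: "h k y \<le> 1" for k y
  proof -
    have "\<bar>x \<bullet> (y /\<^sub>R norm y)\<bar> \<le> norm x * norm (y /\<^sub>R norm y)" by (rule Cauchy_Schwarz_ineq2)
    also have "\<dots> \<le> 1" using x by (cases "y = 0") auto
    finally have "\<bar>x \<bullet> (y /\<^sub>R norm y)\<bar> ^ (2 * k) \<le> 1" by (intro power_le_one) auto
    then show ?thesis by (simp add: h_def power_even_abs)
  qed
  have hom: "h k (c *\<^sub>R y) = h k y" if "c > 0" for c y k
  proof -
    have "(c *\<^sub>R y) /\<^sub>R norm (c *\<^sub>R y) = y /\<^sub>R norm y" using that by (simp add: field_simps)
    then show ?thesis by (simp only: h_def)
  qed
  define C where "C k = enn2real (\<integral>\<^sup>+y\<in>cball 0 1. ennreal (h k y) \<partial>lborel)" for k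
  have fin: "emeasure lborel (cball (0::'a) 1) < \<infinity>" by (rule emeasure_lborel_cball_finite)
  have C: "(\<integral>\<^sup>+y\<in>cball 0 1. ennreal (h k y) \<partial>lborel) = ennreal (C k)" "C k \<ge> 0" for k
  proof -
    have "(\<integral>\<^sup>+y\<in>cball 0 1. ennreal (h k y) \<partial>lborel) \<le> (\<integral>\<^sup>+y\<in>cball (0::'a) 1. 1 \<partial>lborel)"
      using h_le by (intro nn_integral_mono mult_right_mono) (auto simp: ennreal_le_1)
    also have "\<dots> < \<infinity>" using fin by simp
    finally show "(\<integral>\<^sup>+y\<in>cball 0 1. ennreal (h k y) \<partial>lborel) = ennreal (C k)"
      by (simp add: C_def)
  qed (simp add: C_def)
  \<comment> \<open>\<open>P k\<close> is the Gaussian integral of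
    \<open>(x \<bullet> y) ^ (2 * k)\<close>, as shown next, expressed through the wanted integral
    \<open>C k\<close>.\<close>
  define P where "P k = C k * ?d * Gamma (?d + real k)" for k
  have P_nn: "P k \<ge> 0" for k unfolding P_def using C(2)[of k]
    by (intro mult_nonneg_nonneg less_imp_le[OF Gamma_real_pos] add_pos_nonneg) auto
  have P: "(\<integral>\<^sup>+y. ennreal ((x \<bullet> y) ^ (2 * k) * exp (- (norm y)\<^sup>2)) \<partial>lborel) = ennreal (P k)" for k
  proof -
    have "(x \<bullet> y) ^ (2 * k) = h k y * norm y ^ (2 * k)" for y
    proof (cases "y = 0")
      case False
      then have "x \<bullet> y = (x \<bullet> (y /\<^sub>R norm y)) * norm y" by simp
      then show ?thesis by (simp only: h_def power_mult_distrib)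
    qed (simp add: h_def power_0_left)
    then show ?thesis
      using nn_integral_homogeneous_gaussian[of "h k" "C k" k] C h_nn hom by (simp add: P_def)
  qed
  have P0: "(\<integral>\<^sup>+y. ennreal (exp (- (norm (y::'a))\<^sup>2)) \<partial>lborel) = ennreal (P 0)"
    using P[of 0] by simp
  \<comment> \<open>First expansion: the \<open>cosh\<close> series, integrated term by term against
    the Gaussian weight.\<close>
  have sums1: "(\<lambda>k. P k / fact (2 * k) * s ^ (2 * k)) sums (exp (s\<^sup>2 / 4) * P 0)" for s
  proof -
    have "ennreal (exp (s\<^sup>2 / 4) * P 0) = (\<integral>\<^sup>+y. ennreal (cosh (s * (x \<bullet> y)) * exp (- (norm y)\<^sup>2)) \<partial>lborel)"
      unfolding nn_integral_cosh_inner_gaussian[OF x] P0 by (simp add: ennreal_mult P_nn)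
    also have "\<dots> = (\<integral>\<^sup>+y. (\<Sum>k. ennreal (s ^ (2 * k) / fact (2 * k)) *
        ennreal ((x \<bullet> y) ^ (2 * k) * exp (- (norm y)\<^sup>2))) \<partial>lborel)"
    proof (rule nn_integral_cong)
      fix y
      have "(\<lambda>k. (s * (x \<bullet> y)) ^ (2 * k) / fact (2 * k) * exp (- (norm y)\<^sup>2))
          sums (cosh (s * (x \<bullet> y)) * exp (- (norm y)\<^sup>2))"
        by (intro sums_mult2 cosh_sums_even)
      then have "(\<Sum>k. ennreal ((s * (x \<bullet> y)) ^ (2 * k) / fact (2 * k) * exp (- (norm y)\<^sup>2)))
          = ennreal (cosh (s * (x \<bullet> y)) * exp (- (norm y)\<^sup>2))"
        by (intro suminf_ennreal_eq) auto
      then show "ennreal (cosh (s * (x \<bullet> y)) * exp (- (norm y)\<^sup>2)) = (\<Sum>k. ennreal (s ^ (2 * k) / fact (2 * k)) *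
        ennreal ((x \<bullet> y) ^ (2 * k) * exp (- (norm y)\<^sup>2)))"
        by (simp add: power_mult_distrib mult.assoc flip: ennreal_mult)
    qed
    also have "\<dots> = (\<Sum>k. ennreal (s ^ (2 * k) / fact (2 * k)) * ennreal (P k))"
      by (simp add: nn_integral_suminf nn_integral_cmult P)
    also have "\<dots> = (\<Sum>k. ennreal (P k / fact (2 * k) * s ^ (2 * k)))"
      using P_nn by (intro suminf_cong, subst ennreal_mult[symmetric]) (auto simp: mult.commute[of "s ^ _"])
    finally have *: "(\<Sum>k. ennreal (P k / fact (2 * k) * s ^ (2 * k))) = ennreal (exp (s\<^sup>2 / 4) * P 0)" ..
    have "summable (\<lambda>k. P k / fact (2 * k) * s ^ (2 * k))"
      using P_nn * by (intro summable_suminf_not_top) auto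
    moreover from this have "ennreal (\<Sum>k. P k / fact (2 * k) * s ^ (2 * k)) = ennreal (exp (s\<^sup>2 / 4) * P 0)"
      using P_nn * by (subst suminf_ennreal2[symmetric]) auto
    ultimately show ?thesis
      using P_nn by (subst (asm) ennreal_inj) (auto simp: sums_iff suminf_nonneg)
  qed
  \<comment> \<open>Second expansion: the exponential series of the closed form.\<close>
  have sums2: "(\<lambda>k. P 0 / (4 ^ k * fact k) * s ^ (2 * k)) sums (exp (s\<^sup>2 / 4) * P 0)" for s
  proof -
    have "(\<lambda>k. (s\<^sup>2 / 4) ^ k /\<^sub>R fact k * P 0) sums (exp (s\<^sup>2 / 4) * P 0)"
      by (intro sums_mult2 exp_converges)
    then show ?thesis unfolding power_mult by (simp add: power_divide field_simps)
  qed
  have "P k / fact (2 * k) = P 0 / (4 ^ k * fact k)"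
    by (rule even_powser_unique[OF sums1 sums2])
  then have "P k = fact (2 * k) / (4 ^ k * fact k) * P 0" by (simp add: field_simps)
  moreover have "Gamma (?d + real k) = pochhammer ?d k * Gamma ?d"
    using Gamma_add_of_nat[OF d, of k] by (simp add: add.commute)
  moreover have "Gamma ?d \<noteq> 0" "pochhammer ?d k > 0"
    using less_imp_neq[OF Gamma_real_pos[OF d]] pochhammer_pos[OF d] by auto
  ultimately have "C k * pochhammer ?d k * (?d * Gamma ?d) = fact (2 * k) / (4 ^ k * fact k) * C 0 * (?d * Gamma ?d)"
    by (simp add: P_def mult_ac)
  then have "C k * pochhammer ?d k = fact (2 * k) / (4 ^ k * fact k) * C 0"
    using d \<open>Gamma ?d \<noteq> 0\<close> by (subst (asm) mult_cancel_right) auto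
  then have "C k = fact (2 * k) / (4 ^ k * fact k * pochhammer ?d k) * C 0"
    using \<open>pochhammer ?d k > 0\<close> by (simp add: field_simps)
  moreover have "fact (2 * k) / (4 ^ k * fact k * pochhammer ?d k) \<ge> 0"
    using \<open>pochhammer ?d k > 0\<close> by simp
  ultimately have "ennreal (C k) = ennreal (fact (2 * k) / (4 ^ k * fact k * pochhammer ?d k)) * ennreal (C 0)"
    using ennreal_mult C(2)[of 0] by metis
  moreover have "ennreal (C 0) = emeasure lborel (cball (0::'a) 1)"
    using C(1)[of 0] by (simp add: h_def)
  ultimately show ?thesis
    using C(1)[of k] unfolding h_def by metis
qed

section \<open>Laplace transform of the uniform measure on the sphere\<close>

text \<open>This copies the map in the definition of \<open>unif_sphere\<close>, with an arbitrary
  unit vector as value at 0 to keep the range inside the sphere.\<close>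

abbreviation sphere_proj :: "real ^ 'n::finite \<Rightarrow> real ^ 'n" where
  "sphere_proj y \<equiv> (if y = 0 then (SOME y. norm y = (1::real)) else y /\<^sub>R norm y)"

lemma measurable_sphere_proj:
  "sphere_proj \<in> borel \<rightarrow>\<^sub>M restrict_space borel (sphere (0 :: real ^ 'n::finite) 1)"
proof (rule measurable_restrict_space2)
  have "\<exists>y :: real ^ 'n. norm y = 1" using vector_choose_size[of 1] by auto
  from someI_ex[OF this] show "sphere_proj \<in> space borel \<rightarrow> sphere (0 :: real ^ 'n) 1" by auto
qed measurable

lemma sets_unif_sphere: "sets unif_sphere = sets (restrict_space borel (sphere (0 :: real ^ 'n::finite) 1))"
  by (simp add: unif_sphere_def)

lemma space_unif_sphere: "space unif_sphere = sphere (0 :: real ^ 'n::finite) 1"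
  by (simp add: unif_sphere_def space_restrict_space)

lemma emeasure_unit_ball: "emeasure lborel (ball (0 :: 'a::euclidean_space) 1) \<noteq> 0"
    "emeasure lborel (ball (0 :: 'a::euclidean_space) 1) \<noteq> \<infinity>"
proof -
  show fin: "emeasure lborel (ball (0 :: 'a::euclidean_space) 1) \<noteq> \<infinity>"
    using emeasure_lborel_ball_finite[of "0::'a" 1] by simp
  have "measure lborel (ball (0::'a) 1) > 0"
    by (rule content_ball_pos) simp
  then show "emeasure lborel (ball (0 :: 'a::euclidean_space) 1) \<noteq> 0"
    by (auto simp: measure_def)
qed

lemma prob_space_unif_sphere: "prob_space (unif_sphere :: (real ^ 'n::finite) measure)"
  unfolding unif_sphere_def
proof (rule prob_space.prob_space_distr)
  show "prob_space (uniform_measure lborel (ball (0 :: real ^ 'n) 1))"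
    by (intro prob_space_uniform_measure emeasure_unit_ball)
qed (use measurable_sphere_proj in \<open>simp add: measurable_def\<close>)

lemma measurable_unif_sphere:
  "f \<in> borel \<rightarrow>\<^sub>M N \<Longrightarrow> f \<in> (unif_sphere :: (real ^ 'n::finite) measure) \<rightarrow>\<^sub>M N"
  using measurable_restrict_space1[of f borel N "sphere (0 :: real ^ 'n) 1"] measurable_cong_sets[OF sets_unif_sphere refl]
  by blast

text \<open>Closing the ball and changing the value at the origin affects only the null set
  \<open>insert 0 (sphere 0 1)\<close>; the right side then has the form of the moment
  lemma.\<close>

lemma nn_integral_unif_sphere:
  fixes g :: "real ^ 'n::finite \<Rightarrow> ennreal"
  assumes [measurable]: "g \<in> borel_measurable borel"
  shows "(\<integral>\<^sup>+z. g z \<partial>unif_sphere)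
    = (\<integral>\<^sup>+y\<in>cball 0 1. g (y /\<^sub>R norm y) \<partial>lborel) / emeasure lborel (cball (0 :: real ^ 'n) 1)"
proof -
  have [measurable]: "sphere_proj \<in> borel \<rightarrow>\<^sub>M (borel :: (real ^ 'n) measure)"
    by measurable
  have proj: "sphere_proj \<in> uniform_measure lborel (ball 0 1) \<rightarrow>\<^sub>M restrict_space borel (sphere (0 :: real ^ 'n) 1)"
    using measurable_sphere_proj by (simp add: measurable_def)
  have "(\<integral>\<^sup>+z. g z \<partial>unif_sphere) = (\<integral>\<^sup>+y. g (sphere_proj y) \<partial>uniform_measure lborel (ball 0 1))"
    unfolding unif_sphere_def
    by (rule nn_integral_distr[OF proj]) (simp add: measurable_restrict_space1)
  also have "\<dots> = (\<integral>\<^sup>+y\<in>ball 0 1. g (sphere_proj y) \<partial>lborel) / emeasure lborel (ball (0 :: real ^ 'n) 1)"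
    by (rule nn_integral_uniform_measure) auto
  also have "emeasure lborel (ball (0 :: real ^ 'n) 1) = emeasure lborel (cball (0 :: real ^ 'n) 1)"
    by (simp add: emeasure_ball emeasure_cball)
  also have "(\<integral>\<^sup>+y\<in>ball 0 1. g (sphere_proj y) \<partial>lborel) = (\<integral>\<^sup>+y\<in>cball 0 1. g (y /\<^sub>R norm y) \<partial>lborel)"
  proof (rule nn_integral_cong_AE, rule AE_I'[of "insert 0 (sphere 0 1)"])
    have "sphere (0 :: real ^ 'n) 1 \<in> null_sets lborel"
      using negligible_sphere[of "0 :: real ^ 'n" 1]
      by (auto simp: negligible_iff_null_sets null_sets_def)
    moreover have "{0 :: real ^ 'n} \<in> null_sets lborel" by (rule finite_imp_null_set_lborel) simp
    ultimately show "insert 0 (sphere (0 :: real ^ 'n) 1) \<in> null_sets lborel"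
      by (subst insert_is_Un) (rule null_sets.Un)
  qed (auto simp: indicator_def)
  finally show ?thesis .
qed

text \<open>Reflection at the origin preserves both Lebesgue measure and the ball.\<close>

lemma nn_integral_unif_sphere_uminus:
  fixes g :: "real ^ 'n::finite \<Rightarrow> ennreal"
  assumes [measurable]: "g \<in> borel_measurable borel"
  shows "(\<integral>\<^sup>+z. g (- z) \<partial>unif_sphere) = (\<integral>\<^sup>+z. g z \<partial>unif_sphere)"
proof -
  have "(\<integral>\<^sup>+y\<in>cball 0 1. g (y /\<^sub>R norm y) \<partial>lborel) = (\<integral>\<^sup>+y\<in>cball 0 1. g (- (y /\<^sub>R norm y)) \<partial>lborel)"
    using nn_integral_lborel_affine[of "\<lambda>y. g (y /\<^sub>R norm y) * indicator (cball 0 1) y" "- 1" 0]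
    by (simp add: indicator_def)
  then show ?thesis by (simp add: nn_integral_unif_sphere)
qed

lemma nn_integral_unif_sphere_power:
  fixes x :: "real ^ 'n::finite"
  assumes "norm x = 1"
  shows "(\<integral>\<^sup>+z. ennreal ((x \<bullet> z) ^ (2 * k)) \<partial>unif_sphere)
    = ennreal (fact (2 * k) / (4 ^ k * fact k * pochhammer (real CARD('n) / 2) k))"
proof -
  have "emeasure lborel (cball (0 :: real ^ 'n) 1) \<noteq> 0" "emeasure lborel (cball (0 :: real ^ 'n) 1) \<noteq> \<infinity>"
    using emeasure_unit_ball[where 'a = "real ^ 'n"] by (simp_all add: emeasure_ball emeasure_cball)
  then show ?thesis
    using nn_integral_cball_direction_power[OF assms, of k]
    by (simp add: nn_integral_unif_sphere ennreal_mult_divide_eq)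
qed

text \<open>The exponential series can have terms of both signs, so the integrals for
  \<open>b\<close> and \<open>- b\<close> are added first. By symmetry they agree, and their sum is
  the integral of twice the \<open>cosh\<close> series, which the even moments evaluate.\<close>

lemma nn_integral_unif_sphere_exp:
  fixes x :: "real ^ 'n::finite"
  assumes x: "norm x = 1" and N: "CARD('n) \<ge> 2"
  shows "(\<integral>\<^sup>+z. ennreal (exp (b * (x \<bullet> z))) \<partial>unif_sphere) = ennreal (hyp0F1 (real CARD('n) / 2) (b\<^sup>2 / 4))"
proof -
  have [measurable]: "(\<lambda>z. exp (c * (x \<bullet> z))) \<in> borel_measurable unif_sphere"
    "(\<lambda>z. (x \<bullet> z) ^ k) \<in> borel_measurable unif_sphere" for c k
    by (rule measurable_unif_sphere, measurable)+
  let ?E = "\<lambda>b. (\<integral>\<^sup>+z. ennreal (exp (b * (x \<bullet> z))) \<partial>unif_sphere)"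
  have a: "real CARD('n) / 2 \<ge> 1" using N by simp
  have "(\<integral>\<^sup>+z. ennreal (2 * cosh (b * (x \<bullet> z))) \<partial>unif_sphere)
      = (\<integral>\<^sup>+z. ennreal (exp (b * (x \<bullet> z))) + ennreal (exp (- b * (x \<bullet> z))) \<partial>unif_sphere)"
  proof (rule nn_integral_cong)
    fix z
    have "2 * cosh (b * (x \<bullet> z)) = exp (b * (x \<bullet> z)) + exp (- b * (x \<bullet> z))"
      by (simp add: cosh_def)
    then show "ennreal (2 * cosh (b * (x \<bullet> z))) = ennreal (exp (b * (x \<bullet> z))) + ennreal (exp (- b * (x \<bullet> z)))"
      by (simp only: ennreal_plus exp_ge_zero)
  qed
  also have "\<dots> = ?E b + ?E (- b)"
    by (rule nn_integral_add) measurable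
  also have "?E (- b) = ?E b"
    using nn_integral_unif_sphere_uminus[of "\<lambda>z. ennreal (exp (b * (x \<bullet> z)))"] by simp
  finally have 1: "?E b + ?E b = (\<integral>\<^sup>+z. ennreal (2 * cosh (b * (x \<bullet> z))) \<partial>unif_sphere)" ..
  also have "\<dots> = (\<integral>\<^sup>+z. (\<Sum>k. ennreal (2 * (b ^ (2 * k) / fact (2 * k))) * ennreal ((x \<bullet> z) ^ (2 * k))) \<partial>unif_sphere)"
  proof (rule nn_integral_cong)
    fix z
    have "(\<Sum>k. ennreal (2 * ((b * (x \<bullet> z)) ^ (2 * k) / fact (2 * k)))) = ennreal (2 * cosh (b * (x \<bullet> z)))"
      by (intro suminf_ennreal_eq sums_mult cosh_sums_even) auto
    then show "ennreal (2 * cosh (b * (x \<bullet> z)))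
        = (\<Sum>k. ennreal (2 * (b ^ (2 * k) / fact (2 * k))) * ennreal ((x \<bullet> z) ^ (2 * k)))"
      by (simp add: power_mult_distrib mult.assoc flip: ennreal_mult)
  qed
  also have "\<dots> = (\<Sum>k. ennreal (2 * (b ^ (2 * k) / fact (2 * k))) * (\<integral>\<^sup>+z. ennreal ((x \<bullet> z) ^ (2 * k)) \<partial>unif_sphere))"
    by (simp add: nn_integral_suminf nn_integral_cmult)
  also have "\<dots> = (\<Sum>k. ennreal (2 * ((b\<^sup>2 / 4) ^ k / (fact k * pochhammer (real CARD('n) / 2) k))))"
  proof (rule suminf_cong)
    fix k
    have p: "pochhammer (real CARD('n) / 2) k > 0" using pochhammer_ge_1[OF a, of k] by simp
    show "ennreal (2 * (b ^ (2 * k) / fact (2 * k))) * (\<integral>\<^sup>+z. ennreal ((x \<bullet> z) ^ (2 * k)) \<partial>unif_sphere)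
       = ennreal (2 * ((b\<^sup>2 / 4) ^ k / (fact k * pochhammer (real CARD('n) / 2) k)))"
      unfolding nn_integral_unif_sphere_power[OF x] power_mult[of b] using p
      by (subst ennreal_mult[symmetric]) (auto simp: power_divide mult.assoc mult.left_commute)
  qed
  also have "\<dots> = ennreal (2 * hyp0F1 (real CARD('n) / 2) (b\<^sup>2 / 4))"
  proof (intro suminf_ennreal_eq sums_mult hyp0F1_sums a)
    show "0 \<le> 2 * ((b\<^sup>2 / 4) ^ k / (fact k * pochhammer (real CARD('n) / 2) k))" for k
      using pochhammer_ge_1[OF a, of k] by simp
  qed
  also have "\<dots> = ennreal (hyp0F1 (real CARD('n) / 2) (b\<^sup>2 / 4)) + ennreal (hyp0F1 (real CARD('n) / 2) (b\<^sup>2 / 4))"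
    using hyp0F1_pos[OF a, of "b\<^sup>2 / 4"] by (simp flip: ennreal_plus)
  finally have "2 * ?E b = 2 * ennreal (hyp0F1 (real CARD('n) / 2) (b\<^sup>2 / 4))"
    by (simp add: mult_2)
  then show ?thesis by (simp add: ennreal_mult_cancel_left)
qed

lemma
  fixes v :: "real ^ 'n::finite"
  assumes N: "CARD('n) \<ge> 2"
  shows integrable_unif_sphere_exp: "integrable unif_sphere (\<lambda>z. exp (v \<bullet> z))"
    and integral_unif_sphere_exp:
      "(\<integral>z. exp (v \<bullet> z) \<partial>unif_sphere) = hyp0F1 (real CARD('n) / 2) ((norm v)\<^sup>2 / 4)"
proof -
  \<comment> \<open>For \<open>v = 0\<close> any unit vector serves, with
    \<open>b = 0\<close>.\<close>
  obtain x :: "real ^ 'n" and b where x: "norm x = 1" "v = b *\<^sub>R x" "\<bar>b\<bar> = norm v"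
  proof (cases "v = 0")
    case True
    obtain x :: "real ^ 'n" where "norm x = 1" using vector_choose_size[of 1] by auto
    with True that[of x 0] show thesis by auto
  next
    case False
    with that[of "v /\<^sub>R norm v" "norm v"] show thesis by auto
  qed
  have a: "real CARD('n) / 2 \<ge> 1" using N by simp
  have pos: "hyp0F1 (real CARD('n) / 2) ((norm v)\<^sup>2 / 4) > 0" using hyp0F1_pos[OF a] by simp
  have b: "b\<^sup>2 = (norm v)\<^sup>2" using x(3) by (metis power2_abs)
  have nn: "(\<integral>\<^sup>+z. ennreal (exp (v \<bullet> z)) \<partial>unif_sphere) = ennreal (hyp0F1 (real CARD('n) / 2) ((norm v)\<^sup>2 / 4))"
    using nn_integral_unif_sphere_exp[OF x(1) N, of b] by (simp add: x(2) b[unfolded x(2)])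
  have [measurable]: "(\<lambda>z. exp (v \<bullet> z)) \<in> borel_measurable unif_sphere"
    by (intro measurable_unif_sphere) auto
  show "integrable unif_sphere (\<lambda>z. exp (v \<bullet> z))"
    by (rule integrableI_nn_integral_finite[OF _ _ nn]) auto
  show "(\<integral>z. exp (v \<bullet> z) \<partial>unif_sphere) = hyp0F1 (real CARD('n) / 2) ((norm v)\<^sup>2 / 4)"
    by (rule integral_eq_nn_integral[THEN trans]) (use nn pos in auto)
qed

section \<open>Gibbs variational principle\<close>

text \<open>For \<open>f > 0\<close> and \<open>t = p / f\<close> the expression is
  \<open>f * (t - 1 - ln t)\<close>, and \<open>ln t \<le> t - 1\<close> with equality only at
  \<open>t = 1\<close>. For \<open>f = 0\<close> it is \<open>p\<close>, hence positive.\<close>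

lemma entropy_pointwise:
  fixes f p :: real
  assumes f: "f \<ge> 0" and p: "p > 0"
  shows "f * ln f - f * ln p - f + p \<ge> 0"
    and "f * ln f - f * ln p - f + p = 0 \<Longrightarrow> f = p"
proof -
  have *: "f * ln f - f * ln p - f + p = f * ((p / f - 1) - ln (p / f))" if "f > 0"
    using that p by (simp add: ln_div field_simps)
  show "f * ln f - f * ln p - f + p \<ge> 0"
  proof (cases "f = 0")
    case False
    then show ?thesis
      using f p ln_le_minus_one[of "p / f"] by (subst *) (auto intro!: mult_nonneg_nonneg)
  qed (use p in simp)
  show "f = p" if "f * ln f - f * ln p - f + p = 0"
  proof (cases "f = 0")
    case False
    then have "f > 0" using f by simp
    then have "ln (p / f) = p / f - 1" using that * by simp
    then have "p / f = 1" using \<open>f > 0\<close> p by (intro ln_eq_minus_one) auto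
    then show ?thesis using \<open>f > 0\<close> by simp
  qed (use p that in simp)
qed

text \<open>When the entropy is finite, its excess over the integral of \<open>ln p\<close> is the
  integral of a nonnegative function \<open>D\<close>. Equality forces \<open>D = 0\<close> almost
  everywhere, which identifies the density of \<open>\<nu>\<close> with \<open>p\<close>.\<close>

lemma
  fixes M :: "'a measure" and p :: "'a \<Rightarrow> real"
  assumes M: "prob_space M" and \<nu>: "prob_space \<nu>" "sets \<nu> = sets M"
    and p: "p \<in> borel_measurable M" "\<And>x. p x > 0" "integrable M p" "(\<integral>x. p x \<partial>M) = 1"
    and lnp: "integrable \<nu> (\<lambda>x. ln (p x))"
  shows gibbs_inequality: "ereal (\<integral>x. ln (p x) \<partial>\<nu>) \<le> rel_entropy \<nu> M"
    and gibbs_equality: "rel_entropy \<nu> M \<le> ereal (\<integral>x. ln (p x) \<partial>\<nu>) \<Longrightarrow> \<nu> = density M (\<lambda>x. ennreal (p x))"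
proof -
  interpret M: prob_space M by fact
  interpret \<nu>: prob_space \<nu> by fact
  define f where "f x = enn2real (RN_deriv M \<nu> x)" for x
  define ok where "ok \<longleftrightarrow> absolutely_continuous M \<nu> \<and> integrable M (\<lambda>x. f x * ln (f x))"
  have H: "rel_entropy \<nu> M = (if ok then ereal (\<integral>x. f x * ln (f x) \<partial>M) else \<infinity>)"
    unfolding rel_entropy_def Let_def ok_def f_def using \<nu>(2) by simp
  have [measurable]: "f \<in> borel_measurable M" "p \<in> borel_measurable M"
    unfolding f_def using p(1) by auto
  have f0: "f x \<ge> 0" for x by (simp add: f_def)
  \<comment> \<open>The correction \<open>- f x + p x\<close> integrates to 0 once \<open>ok\<close>
    makes \<open>f\<close> a probability density, and it renders the integrand pointwise
    nonnegative.\<close>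
  define D where "D x = f x * ln (f x) - f x * ln (p x) - f x + p x" for x
  have D0: "D x \<ge> 0" for x unfolding D_def using f0 p(2) by (rule entropy_pointwise)
  have Df: "f x = p x" if "D x = 0" for x
    using that unfolding D_def by (rule entropy_pointwise(2)[OF f0 p(2)])
  have facts: "\<nu> = density M (\<lambda>x. ennreal (f x))" "integrable M D"
    "(\<integral>x. D x \<partial>M) = (\<integral>x. f x * ln (f x) \<partial>M) - (\<integral>x. ln (p x) \<partial>\<nu>)" if ok
  proof -
    have ac: "absolutely_continuous M \<nu>" and int: "integrable M (\<lambda>x. f x * ln (f x))"
      using that by (auto simp: ok_def)
    have "AE x in M. RN_deriv M \<nu> x \<noteq> \<infinity>"
      using \<nu>(2) by (intro M.RN_deriv_finite ac \<nu>.sigma_finite_measure) auto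
    then have "AE x in M. RN_deriv M \<nu> x = ennreal (f x)"
      by eventually_elim (simp add: f_def top.not_eq_extremum)
    then have "density M (RN_deriv M \<nu>) = density M (\<lambda>x. ennreal (f x))"
      by (intro density_cong) auto
    then show eq: "\<nu> = density M (\<lambda>x. ennreal (f x))"
      using M.density_RN_deriv[OF ac \<nu>(2)] by simp
    have "integrable \<nu> (\<lambda>x. 1::real)" by simp
    then have intf: "integrable M f"
      using f0 unfolding eq by (simp add: integrable_density)
    have f1: "(\<integral>x. f x \<partial>M) = 1"
      using integral_density[of "\<lambda>_. 1::real" M f] f0 \<nu>.prob_space unfolding eq[symmetric] by simp
    have intp: "integrable M (\<lambda>x. f x * ln (p x))" and fp: "(\<integral>x. f x * ln (p x) \<partial>M) = (\<integral>x. ln (p x) \<partial>\<nu>)"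
      using lnp f0 unfolding eq by (auto simp: integrable_density integral_density)
    show "integrable M D"
      unfolding D_def by (intro Bochner_Integration.integrable_add Bochner_Integration.integrable_diff int intp intf p)
    show "(\<integral>x. D x \<partial>M) = (\<integral>x. f x * ln (f x) \<partial>M) - (\<integral>x. ln (p x) \<partial>\<nu>)"
      unfolding D_def using int intp intf p(3) by (simp add: fp f1 p(4))
  qed
  show "ereal (\<integral>x. ln (p x) \<partial>\<nu>) \<le> rel_entropy \<nu> M"
  proof (cases ok)
    case True
    have "(\<integral>x. D x \<partial>M) \<ge> 0" using D0 by simp
    then show ?thesis using facts(3)[OF True] True by (simp add: H)
  qed (simp add: H)
  assume le: "rel_entropy \<nu> M \<le> ereal (\<integral>x. ln (p x) \<partial>\<nu>)"
  then have ok by (auto simp: H split: if_splits)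
  have "(\<integral>x. D x \<partial>M) \<ge> 0" using D0 by simp
  then have "(\<integral>x. D x \<partial>M) = 0" using facts(3)[OF \<open>ok\<close>] le \<open>ok\<close> by (simp add: H)
  then have "AE x in M. D x = 0"
    using integral_nonneg_eq_0_iff_AE[OF facts(2)[OF \<open>ok\<close>]] D0 by simp
  then have "AE x in M. ennreal (f x) = ennreal (p x)"
    by eventually_elim (simp add: Df)
  then have "density M (\<lambda>x. ennreal (f x)) = density M (\<lambda>x. ennreal (p x))"
    by (intro density_cong) auto
  then show "\<nu> = density M (\<lambda>x. ennreal (p x))" using facts(1)[OF \<open>ok\<close>] by simp
qed

lemma rel_entropy_density:
  fixes M :: "'a measure" and p :: "'a \<Rightarrow> real"
  assumes M: "prob_space M" and p: "p \<in> borel_measurable M" "\<And>x. p x \<ge> 0"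
    and plnp: "integrable M (\<lambda>x. p x * ln (p x))"
  shows "rel_entropy (density M (\<lambda>x. ennreal (p x))) M = ereal (\<integral>x. p x * ln (p x) \<partial>M)"
proof -
  interpret M: prob_space M by fact
  have [measurable]: "p \<in> borel_measurable M" by fact
  let ?\<nu> = "density M (\<lambda>x. ennreal (p x))"
  let ?f = "\<lambda>x. enn2real (RN_deriv M ?\<nu> x)"
  have "AE x in M. ennreal (p x) = RN_deriv M ?\<nu> x"
    by (rule M.RN_deriv_unique) auto
  then have AE: "AE x in M. ?f x * ln (?f x) = p x * ln (p x)"
    by eventually_elim (metis enn2real_ennreal p(2))
  have "absolutely_continuous M ?\<nu>"
    by (rule absolutely_continuousI_density) simp
  moreover have "integrable M (\<lambda>x. ?f x * ln (?f x))"
    using integrable_cong_AE[OF _ _ AE] plnp by simp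
  moreover have "(\<integral>x. ?f x * ln (?f x) \<partial>M) = (\<integral>x. p x * ln (p x) \<partial>M)"
    using AE by (intro integral_cong_AE) auto
  ultimately show ?thesis by (simp add: rel_entropy_def)
qed

section \<open>Exponentially tilted measures on the sphere\<close>

definition log_mgf :: "real \<Rightarrow> real \<Rightarrow> real" where
  "log_mgf a b = ln (hyp0F1 a (b\<^sup>2 / 4))"

lemma log_mgf_0 [simp]: "log_mgf a 0 = 0"
  by (simp add: log_mgf_def)

lemma log_mgf_abs [simp]: "log_mgf a \<bar>b\<bar> = log_mgf a b"
  by (simp add: log_mgf_def)

lemma exp_log_mgf: "a \<ge> 1 \<Longrightarrow> exp (log_mgf a b) = hyp0F1 a (b\<^sup>2 / 4)"
  by (simp add: log_mgf_def hyp0F1_pos)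

lemma DERIV_log_mgf:
  "a \<ge> 1 \<Longrightarrow> (log_mgf a has_real_derivative b * bessel_quot a b) (at b)"
  using DERIV_ln_hyp0F1[of a b] by (simp add: log_mgf_def[abs_def])

text \<open>The derivative \<open>t * (1 / \<beta> - bessel_quot a t)\<close> changes sign from
  negative to positive at \<open>b0\<close>. It vanishes at 0 and at \<open>b0\<close>, hence the
  monotonicity rules that ask for a sign only inside the interval.\<close>

lemma log_mgf_tilted_min:
  assumes a: "a \<ge> 1" and \<beta>: "\<beta> > 0" and b0: "b0 \<ge> 0" "bessel_quot a b0 = 1 / \<beta>"
    and b: "b \<ge> 0" "b \<noteq> b0"
  shows "b0\<^sup>2 / (2 * \<beta>) - log_mgf a b0 < b\<^sup>2 / (2 * \<beta>) - log_mgf a b"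
proof -
  define G where "G t = t\<^sup>2 / (2 * \<beta>) - log_mgf a t" for t
  have G': "(G has_real_derivative t * (1 / \<beta> - bessel_quot a t)) (at t)" for t
    unfolding G_def using \<beta>
    by (auto intro!: derivative_eq_intros DERIV_log_mgf[OF a] simp: field_simps)
  have cont: "continuous_on A G" for A
    by (intro continuous_at_imp_continuous_on ballI DERIV_isCont[OF G'])
  have "G b0 < G b"
  proof (cases "b < b0")
    case True
    show ?thesis
    proof (rule DERIV_neg_imp_decreasing_open[OF True])
      fix t assume "b < t" "t < b0"
      moreover from this have "bessel_quot a t > 1 / \<beta>"
        using bessel_quot_strict_decreasing[OF a, of t b0] b b0 by simp
      ultimately show "\<exists>y. (G has_real_derivative y) (at t) \<and> y < 0"
        using b by (intro exI[of _ "t * (1 / \<beta> - bessel_quot a t)"] conjI G' mult_pos_neg) auto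
    qed (rule cont)
  next
    case False
    with b have lt: "b0 < b" by simp
    show ?thesis
    proof (rule DERIV_pos_imp_increasing_open[OF lt])
      fix t assume "b0 < t" "t < b"
      moreover from this have "bessel_quot a t < 1 / \<beta>"
        using bessel_quot_strict_decreasing[OF a, of b0 t] b b0 by simp
      ultimately show "\<exists>y. (G has_real_derivative y) (at t) \<and> y > 0"
        using b0 by (intro exI[of _ "t * (1 / \<beta> - bessel_quot a t)"] conjI G' mult_pos_pos) auto
    qed (rule cont)
  qed
  then show ?thesis by (simp add: G_def)
qed

text \<open>The previous lemma with \<open>\<beta> = 2 * a\<close> and \<open>b0 = 0\<close>, where
  the quotient equals \<open>1 / (2 * a)\<close>.\<close>

lemma log_mgf_less_quadratic:
  assumes "a \<ge> 1" "b > 0"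
  shows "log_mgf a b < b\<^sup>2 / (4 * a)"
  using log_mgf_tilted_min[of a "2 * a" 0 b] assms by (simp add: bessel_quot_0)

lemma log_mgf_le_quadratic: "a \<ge> 1 \<Longrightarrow> b \<ge> 0 \<Longrightarrow> log_mgf a b \<le> b\<^sup>2 / (4 * a)"
  using log_mgf_less_quadratic[of a b] by (cases "b = 0") auto

lemma prob_on_sphere_unif: "prob_on_sphere (unif_sphere :: (real ^ 'n::finite) measure)"
  by (simp add: prob_on_sphere_def prob_space_unif_sphere)

lemma
  assumes "prob_on_sphere (\<nu> :: (real ^ 'n::finite) measure)"
  shows integrable_inner_prob_on_sphere: "integrable \<nu> (\<lambda>z. v \<bullet> z)"
    and integral_inner_prob_on_sphere: "(\<integral>z. v \<bullet> z \<partial>\<nu>) = v \<bullet> (\<integral>z. z \<partial>\<nu>)"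
    and norm_mean_prob_on_sphere: "norm (\<integral>z. z \<partial>\<nu>) \<le> 1"
proof -
  interpret prob_space \<nu> using assms by (simp add: prob_on_sphere_def)
  have sets: "sets \<nu> = sets unif_sphere" using assms by (simp add: prob_on_sphere_def)
  have sp: "space \<nu> = sphere 0 1"
    using sets_eq_imp_space_eq[OF sets] by (simp add: space_unif_sphere)
  have [measurable]: "(\<lambda>z. z) \<in> borel_measurable \<nu>"
    using measurable_unif_sphere[of "\<lambda>z. z" borel] measurable_cong_sets[OF sets refl, of borel] by auto
  have "integrable \<nu> (\<lambda>z. z)"
    by (rule integrable_const_bound[of _ 1]) (auto simp: sp)
  then show "integrable \<nu> (\<lambda>z. v \<bullet> z)" "(\<integral>z. v \<bullet> z \<partial>\<nu>) = v \<bullet> (\<integral>z. z \<partial>\<nu>)"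
    by auto
  have "norm (\<integral>z. z \<partial>\<nu>) \<le> (\<integral>z. norm z \<partial>\<nu>)"
    by (rule integral_norm_bound)
  also have "\<dots> = (\<integral>z. 1 \<partial>\<nu>)"
    by (rule Bochner_Integration.integral_cong) (auto simp: sp)
  finally show "norm (\<integral>z. z \<partial>\<nu>) \<le> 1" by (simp add: prob_space)
qed

text \<open>A vector parameter covers direction and strength at once and allows
  \<open>v = 0\<close>; in dimension at least 2, subtracting \<open>log_mgf\<close> in the exponent
  normalizes the mass to 1.\<close>

definition tilt :: "real ^ 'n::finite \<Rightarrow> (real ^ 'n) measure" where
  "tilt v = density unif_sphere (\<lambda>z. ennreal (exp (v \<bullet> z - log_mgf (real CARD('n) / 2) (norm v))))"

lemma vmf_eq_tilt:
  fixes x :: "real ^ 'n::finite"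
  assumes "CARD('n) \<ge> 2" "norm x = 1"
  shows "vmf b x = tilt (b *\<^sub>R x)"
  using integral_unif_sphere_exp[OF assms(1), of "b *\<^sub>R x"] assms
  by (simp add: vmf_def tilt_def exp_diff exp_log_mgf)

lemma tilt_0: "tilt 0 = unif_sphere"
  by (simp add: tilt_def density_1)

lemma
  fixes v :: "real ^ 'n::finite"
  assumes "CARD('n) \<ge> 2"
  shows integrable_tilt_density:
      "integrable unif_sphere (\<lambda>z. exp (v \<bullet> z - log_mgf (real CARD('n) / 2) (norm v)))"
    and integral_tilt_density:
      "(\<integral>z. exp (v \<bullet> z - log_mgf (real CARD('n) / 2) (norm v)) \<partial>unif_sphere) = 1"
proof -
  have a: "real CARD('n) / 2 \<ge> 1" using assms by simp
  show "integrable unif_sphere (\<lambda>z. exp (v \<bullet> z - log_mgf (real CARD('n) / 2) (norm v)))"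
    using integrable_unif_sphere_exp[OF assms, of v] by (simp add: exp_diff)
  show "(\<integral>z. exp (v \<bullet> z - log_mgf (real CARD('n) / 2) (norm v)) \<partial>unif_sphere) = 1"
    using integral_unif_sphere_exp[OF assms, of v] hyp0F1_pos[OF a, of "(norm v)\<^sup>2 / 4"]
    by (simp add: exp_diff exp_log_mgf[OF a])
qed

lemma prob_on_sphere_tilt:
  fixes v :: "real ^ 'n::finite"
  assumes "CARD('n) \<ge> 2"
  shows "prob_on_sphere (tilt v)"
proof -
  have m: "(\<lambda>z. ennreal (exp (v \<bullet> z - log_mgf (real CARD('n) / 2) (norm v)))) \<in> borel_measurable unif_sphere"
    by (rule measurable_unif_sphere) measurable
  have "prob_space (tilt v)"
  proof (rule prob_spaceI)
    have "(\<integral>\<^sup>+z. ennreal (exp (v \<bullet> z - log_mgf (real CARD('n) / 2) (norm v))) \<partial>unif_sphere) = ennreal 1"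
      unfolding integral_tilt_density[OF assms, symmetric, of v]
      by (rule nn_integral_eq_integral[OF integrable_tilt_density[OF assms]]) simp
    also have "(\<integral>\<^sup>+z. ennreal (exp (v \<bullet> z - log_mgf (real CARD('n) / 2) (norm v))) \<partial>unif_sphere)
        = (\<integral>\<^sup>+z\<in>space unif_sphere. ennreal (exp (v \<bullet> z - log_mgf (real CARD('n) / 2) (norm v))) \<partial>unif_sphere)"
      by (rule nn_integral_cong) simp
    finally show "emeasure (tilt v) (space (tilt v)) = 1"
      unfolding tilt_def space_density by (subst emeasure_density[OF m]) auto
  qed
  then show ?thesis by (simp add: prob_on_sphere_def tilt_def)
qed

text \<open>The logarithm of the tilted density is affine in \<open>z\<close>, so its integral sees
  only the mean of \<open>\<nu>\<close>; the Gibbs principle does the rest.\<close>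

lemma
  fixes v :: "real ^ 'n::finite"
  assumes N: "CARD('n) \<ge> 2" and \<nu>: "prob_on_sphere \<nu>"
  shows rel_entropy_sphere_ge:
      "ereal (v \<bullet> (\<integral>z. z \<partial>\<nu>) - log_mgf (real CARD('n) / 2) (norm v)) \<le> rel_entropy \<nu> unif_sphere"
    and rel_entropy_sphere_eq:
      "rel_entropy \<nu> unif_sphere \<le> ereal (v \<bullet> (\<integral>z. z \<partial>\<nu>) - log_mgf (real CARD('n) / 2) (norm v))
        \<Longrightarrow> \<nu> = tilt v"
proof -
  interpret \<nu>: prob_space \<nu> using \<nu> by (simp add: prob_on_sphere_def)
  let ?L = "log_mgf (real CARD('n) / 2) (norm v)"
  let ?p = "\<lambda>z. exp (v \<bullet> z - ?L)"
  have sets: "sets \<nu> = sets unif_sphere" using \<nu> by (simp add: prob_on_sphere_def)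
  have m: "?p \<in> borel_measurable unif_sphere"
    by (rule measurable_unif_sphere) measurable
  have ln: "(\<integral>z. ln (?p z) \<partial>\<nu>) = v \<bullet> (\<integral>z. z \<partial>\<nu>) - ?L"
    using integrable_inner_prob_on_sphere[OF \<nu>, of v] integral_inner_prob_on_sphere[OF \<nu>, of v]
    by (simp add: \<nu>.prob_space)
  have int: "integrable \<nu> (\<lambda>z. ln (?p z))"
    using integrable_inner_prob_on_sphere[OF \<nu>, of v] by simp
  note * = prob_space_unif_sphere \<nu>.prob_space_axioms sets m exp_gt_zero
    integrable_tilt_density[OF N] integral_tilt_density[OF N] int
  show "ereal (v \<bullet> (\<integral>z. z \<partial>\<nu>) - ?L) \<le> rel_entropy \<nu> unif_sphere"
    using gibbs_inequality[OF *] unfolding ln .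
  show "\<nu> = tilt v" if "rel_entropy \<nu> unif_sphere \<le> ereal (v \<bullet> (\<integral>z. z \<partial>\<nu>) - ?L)"
    using gibbs_equality[OF *] that unfolding ln tilt_def by blast
qed

text \<open>The lower bound above is attained: the entropy is the integral of the logarithm of the
  density against the tilted measure itself.\<close>

lemma rel_entropy_tilt:
  fixes v :: "real ^ 'n::finite"
  assumes N: "CARD('n) \<ge> 2"
  shows "rel_entropy (tilt v) unif_sphere
    = ereal (v \<bullet> (\<integral>z. z \<partial>tilt v) - log_mgf (real CARD('n) / 2) (norm v))"
proof -
  let ?L = "log_mgf (real CARD('n) / 2) (norm v)"
  let ?p = "\<lambda>z. exp (v \<bullet> z - ?L)"
  note \<nu> = prob_on_sphere_tilt[OF N, of v]
  interpret \<nu>: prob_space "tilt v" using \<nu> by (simp add: prob_on_sphere_def)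
  have [measurable]: "?p \<in> borel_measurable unif_sphere" "(\<lambda>z. v \<bullet> z - ?L) \<in> borel_measurable unif_sphere"
    by (rule measurable_unif_sphere, measurable)+
  have "integrable (tilt v) (\<lambda>z. v \<bullet> z - ?L)"
    using integrable_inner_prob_on_sphere[OF \<nu>, of v] by simp
  then have "integrable unif_sphere (\<lambda>z. ?p z * ln (?p z))"
    unfolding tilt_def by (simp add: integrable_density)
  then have "rel_entropy (tilt v) unif_sphere = ereal (\<integral>z. ?p z * ln (?p z) \<partial>unif_sphere)"
    unfolding tilt_def by (intro rel_entropy_density prob_space_unif_sphere) auto
  also have "(\<integral>z. ?p z * ln (?p z) \<partial>unif_sphere) = (\<integral>z. v \<bullet> z - ?L \<partial>tilt v)"
    unfolding tilt_def by (simp add: integral_density)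
  also have "\<dots> = v \<bullet> (\<integral>z. z \<partial>tilt v) - ?L"
    using integrable_inner_prob_on_sphere[OF \<nu>, of v] integral_inner_prob_on_sphere[OF \<nu>, of v]
    by (simp add: \<nu>.prob_space)
  finally show ?thesis .
qed

text \<open>For the tilted measure with parameter \<open>b *\<^sub>R x\<close> the Gibbs inequality says that
  \<open>b' \<mapsto> b' * c - log_mgf a b'\<close>, with \<open>c\<close> its mean in direction \<open>x\<close>, is maximal at \<open>b\<close>;
  hence \<open>c\<close> is the derivative of \<open>log_mgf a\<close> at \<open>b\<close>.\<close>
lemma inner_mean_tilt:
  fixes x :: "real ^ 'n::finite"
  assumes N: "CARD('n) \<ge> 2" and x: "norm x = 1"
  shows "x \<bullet> (\<integral>z. z \<partial>tilt (b *\<^sub>R x)) = b * bessel_quot (real CARD('n) / 2) b"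
proof -
  let ?a = "real CARD('n) / 2"
  have a: "?a \<ge> 1" using N by simp
  let ?c = "x \<bullet> (\<integral>z. z \<partial>tilt (b *\<^sub>R x))"
  have "b' * ?c - log_mgf ?a b' \<le> b * ?c - log_mgf ?a b" for b'
    using rel_entropy_sphere_ge[OF N prob_on_sphere_tilt[OF N, of "b *\<^sub>R x"], of "b' *\<^sub>R x"]
    unfolding rel_entropy_tilt[OF N] using x by simp
  \<comment> \<open>The minimum at \<open>b\<close> is global, so the radius 1 is an arbitrary
    choice.\<close>
  then have "\<forall>b'. \<bar>b - b'\<bar> < 1 \<longrightarrow> log_mgf ?a b - b * ?c \<le> log_mgf ?a b' - b' * ?c"
    by (simp add: algebra_simps)
  moreover have "((\<lambda>b. log_mgf ?a b - b * ?c) has_real_derivative b * bessel_quot ?a b - ?c) (at b)"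
    by (auto intro!: derivative_eq_intros DERIV_log_mgf[OF a])
  ultimately have "b * bessel_quot ?a b - ?c = 0"
    by (intro DERIV_local_min[of "\<lambda>b. log_mgf ?a b - b * ?c" _ b 1]) auto
  then show ?thesis by simp
qed

lemma obtain_unit_vector:
  obtains x :: "real ^ 'n::finite" where "norm x = 1"
  using vector_choose_size[of 1] by auto

text \<open>\<open>b * bessel_quot a b\<close> is a component of a mean lying in the unit ball. The
  bound supplies the right endpoint \<open>\<beta>\<close> of the intermediate value argument for
  the fixed point.\<close>

lemma bessel_quot_le:
  assumes N: "CARD('n::finite) \<ge> 2" and b: "b > 0"
  shows "bessel_quot (real CARD('n) / 2) b \<le> 1 / b"
proof -
  obtain x :: "real ^ 'n" where x: "norm x = 1" by (rule obtain_unit_vector)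
  have "b * bessel_quot (real CARD('n) / 2) b = x \<bullet> (\<integral>z. z \<partial>tilt (b *\<^sub>R x))"
    using inner_mean_tilt[OF N x] by simp
  also have "\<dots> \<le> norm x * norm (\<integral>z. z \<partial>tilt (b *\<^sub>R x))"
    by (rule norm_cauchy_schwarz)
  also have "\<dots> \<le> 1"
    using x norm_mean_prob_on_sphere[OF prob_on_sphere_tilt[OF N, of "b *\<^sub>R x"]] by simp
  finally show ?thesis using b by (simp add: field_simps)
qed

text \<open>Convexity without second derivatives: it is the Gibbs inequality for
  \<open>tilt (b *\<^sub>R x)\<close>, tested with the parameter
  \<open>b' *\<^sub>R x\<close>.\<close>

lemma log_mgf_above_tangent:
  assumes N: "CARD('n::finite) \<ge> 2"
  defines "a \<equiv> real CARD('n) / 2"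
  shows "log_mgf a b' \<ge> log_mgf a b + b * bessel_quot a b * (b' - b)"
proof -
  obtain x :: "real ^ 'n" where x: "norm x = 1" by (rule obtain_unit_vector)
  have "b' * (b * bessel_quot a b) - log_mgf a b' \<le> b * (b * bessel_quot a b) - log_mgf a b"
    using rel_entropy_sphere_ge[OF N prob_on_sphere_tilt[OF N, of "b *\<^sub>R x"], of "b' *\<^sub>R x"]
    unfolding rel_entropy_tilt[OF N] using x by (simp add: inner_mean_tilt[OF N x] a_def)
  then show ?thesis by (simp add: algebra_simps)
qed

text \<open>Equality would force \<open>x \<bullet> z\<close> to be almost everywhere constant on the sphere, so that
  \<open>log_mgf a\<close>, being even, would vanish.\<close>
lemma log_mgf_above_tangent_strict:
  assumes N: "CARD('n::finite) \<ge> 2"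
  defines "a \<equiv> real CARD('n) / 2"
  assumes b: "b > 0" "b' \<noteq> b"
  shows "log_mgf a b' > log_mgf a b + b * bessel_quot a b * (b' - b)"
proof (rule ccontr)
  assume neg: "\<not> ?thesis"
  obtain x :: "real ^ 'n" where x: "norm x = 1" by (rule obtain_unit_vector)
  have a: "a \<ge> 1" using N by (simp add: a_def)
  \<comment> \<open>The negated claim says that \<open>tilt (b *\<^sub>R x)\<close> attains the
    Gibbs bound for the parameter \<open>b' *\<^sub>R x\<close>, so the two tilted measures
    coincide.\<close>
  have "b * (b * bessel_quot a b) - log_mgf a b \<le> b' * (b * bessel_quot a b) - log_mgf a b'"
    using neg by (simp add: algebra_simps not_less)
  then have "rel_entropy (tilt (b *\<^sub>R x)) unif_sphere \<le> ereal ((b' *\<^sub>R x) \<bullet> (\<integral>z. z \<partial>tilt (b *\<^sub>R x)) - log_mgf a (norm (b' *\<^sub>R x)))"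
    unfolding rel_entropy_tilt[OF N] using x by (simp add: inner_mean_tilt[OF N x] a_def)
  then have eq: "tilt (b *\<^sub>R x) = tilt (b' *\<^sub>R x)"
    unfolding a_def by (rule rel_entropy_sphere_eq[OF N prob_on_sphere_tilt[OF N]])
  interpret \<mu>: prob_space "unif_sphere :: (real ^ 'n) measure" by (rule prob_space_unif_sphere)
  have m: "(\<lambda>z. ennreal (exp (v \<bullet> z - c))) \<in> borel_measurable (unif_sphere :: (real ^ 'n) measure)" for v c
    by (rule measurable_unif_sphere) measurable
  have "AE z in unif_sphere. ennreal (exp ((b *\<^sub>R x) \<bullet> z - log_mgf a (norm (b *\<^sub>R x))))
      = ennreal (exp ((b' *\<^sub>R x) \<bullet> z - log_mgf a (norm (b' *\<^sub>R x))))"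
    using \<mu>.density_unique[OF m m eq[unfolded tilt_def]] unfolding a_def .
  \<comment> \<open>Equality of the densities is a linear equation for \<open>x \<bullet> z\<close>,
    solvable because \<open>b' \<noteq> b\<close>.\<close>
  then have AE: "AE z in unif_sphere. x \<bullet> z = (log_mgf a b - log_mgf a b') / (b - b')"
  proof eventually_elim
    case (elim z)
    then have "b * (x \<bullet> z) - log_mgf a b = b' * (x \<bullet> z) - log_mgf a b'" using x by simp
    then show ?case using b by (simp add: field_simps)
  qed
  define c where "c = (log_mgf a b - log_mgf a b') / (b - b')"
  have L: "log_mgf a s = s * c" for s
  proof -
    have m1: "(\<lambda>z. exp ((s *\<^sub>R x) \<bullet> z)) \<in> borel_measurable unif_sphere"
      by (rule measurable_unif_sphere) measurable
    have "hyp0F1 a (s\<^sup>2 / 4) = (\<integral>z. exp ((s *\<^sub>R x) \<bullet> z) \<partial>unif_sphere)"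
      using integral_unif_sphere_exp[OF N, of "s *\<^sub>R x"] x by (simp add: a_def)
    also have "\<dots> = (\<integral>z. exp (s * c) \<partial>(unif_sphere :: (real ^ 'n) measure))"
      using AE by (intro integral_cong_AE m1) (auto simp: c_def elim!: eventually_mono)
    also have "\<dots> = exp (s * c)" by (simp add: \<mu>.prob_space)
    finally show ?thesis by (simp add: log_mgf_def)
  qed
  have "c = 0" using L[of 1] L[of "- 1"] log_mgf_abs[of a "- 1"] by simp
  then have "log_mgf a = (\<lambda>_. 0)" using L by auto
  then have "b * bessel_quot a b = 0"
    using DERIV_log_mgf[OF a, of b] DERIV_unique DERIV_const by metis
  then show False using b bessel_quot_pos[OF a, of b] by simp
qed

section \<open>Bounds for the free energy and for \<open>Phi\<close>\<close>

text \<open>With \<open>v = \<beta> *\<^sub>R m\<close> the linear term of the Gibbs bound is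
  \<open>\<beta> * (norm m)\<^sup>2\<close>, twice the interaction term, so half of it
  remains.\<close>

lemma free_energy_ge:
  fixes \<nu> :: "(real ^ 'n::finite) measure"
  assumes N: "CARD('n) \<ge> 2" and \<beta>: "\<beta> \<ge> 0" and \<nu>: "prob_on_sphere \<nu>"
  defines "m \<equiv> \<integral>z. z \<partial>\<nu>"
  shows "ereal (\<beta> / 2 * (norm m)\<^sup>2 - log_mgf (real CARD('n) / 2) (\<beta> * norm m)) \<le> free_energy \<beta> \<nu>"
    and "free_energy \<beta> \<nu> \<le> ereal (\<beta> / 2 * (norm m)\<^sup>2 - log_mgf (real CARD('n) / 2) (\<beta> * norm m))
      \<Longrightarrow> \<nu> = tilt (\<beta> *\<^sub>R m)"
proof -
  let ?L = "log_mgf (real CARD('n) / 2) (\<beta> * norm m)"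
  have ge: "ereal (\<beta> * (norm m)\<^sup>2 - ?L) \<le> rel_entropy \<nu> unif_sphere"
    and eq: "rel_entropy \<nu> unif_sphere \<le> ereal (\<beta> * (norm m)\<^sup>2 - ?L) \<Longrightarrow> \<nu> = tilt (\<beta> *\<^sub>R m)"
    using rel_entropy_sphere_ge[OF N \<nu>, of "\<beta> *\<^sub>R m"] rel_entropy_sphere_eq[OF N \<nu>, of "\<beta> *\<^sub>R m"] \<beta>
    unfolding m_def[symmetric] by (simp_all add: power2_norm_eq_inner)
  show "ereal (\<beta> / 2 * (norm m)\<^sup>2 - ?L) \<le> free_energy \<beta> \<nu>"
    using ge unfolding free_energy_def m_def[symmetric]
    by (cases "rel_entropy \<nu> unif_sphere") (auto simp: field_simps)
  show "\<nu> = tilt (\<beta> *\<^sub>R m)" if "free_energy \<beta> \<nu> \<le> ereal (\<beta> / 2 * (norm m)\<^sup>2 - ?L)"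
    using that eq unfolding free_energy_def m_def[symmetric]
    by (cases "rel_entropy \<nu> unif_sphere") (auto simp: field_simps)
qed

text \<open>Only the component of the mean along \<open>x\<close> has been computed. It is at most
  the norm of the mean, which is the direction needed for an upper bound.\<close>

lemma free_energy_tilt_le:
  fixes x :: "real ^ 'n::finite"
  assumes N: "CARD('n) \<ge> 2" and \<beta>: "\<beta> \<ge> 0" and x: "norm x = 1" and b: "b \<ge> 0"
  defines "a \<equiv> real CARD('n) / 2"
  shows "free_energy \<beta> (tilt (b *\<^sub>R x))
    \<le> ereal (b * (b * bessel_quot a b) - log_mgf a b - \<beta> / 2 * (b * bessel_quot a b)\<^sup>2)"
proof -
  let ?m = "\<integral>z. z \<partial>tilt (b *\<^sub>R x)"
  have a: "a \<ge> 1" using N by (simp add: a_def)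
  have r: "x \<bullet> ?m = b * bessel_quot a b" using inner_mean_tilt[OF N x] by (simp add: a_def)
  have "0 \<le> b * bessel_quot a b" using b bessel_quot_pos[OF a, of b] by simp
  moreover have "b * bessel_quot a b \<le> norm ?m"
    using norm_cauchy_schwarz[of x ?m] x r by simp
  ultimately have "(b * bessel_quot a b)\<^sup>2 \<le> (norm ?m)\<^sup>2" by (rule power_mono[rotated])
  then have "\<beta> / 2 * (b * bessel_quot a b)\<^sup>2 \<le> \<beta> / 2 * (norm ?m)\<^sup>2"
    using \<beta> by (intro mult_left_mono) auto
  moreover have "rel_entropy (tilt (b *\<^sub>R x)) unif_sphere = ereal (b * (b * bessel_quot a b) - log_mgf a b)"
    unfolding rel_entropy_tilt[OF N] using x by (simp add: r a_def[symmetric])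
  ultimately show ?thesis by (simp add: free_energy_def)
qed

text \<open>The tangent to \<open>log_mgf a\<close> at \<open>b\<close> has slope \<open>r\<close>;
  it is evaluated at \<open>\<beta> * r\<close>. The bound has the shape of
  \<open>free_energy_ge\<close> with \<open>r\<close> for \<open>norm m\<close>, so the same
  estimates serve both minimizations.\<close>

lemma Phi_ge:
  assumes N: "CARD('n::finite) \<ge> 2" and b: "b \<ge> 0"
  defines "a \<equiv> real CARD('n) / 2"
  defines "r \<equiv> b * bessel_quot a b"
  shows "Phi CARD('n) \<beta> 0 + (\<beta> / 2 * r\<^sup>2 - log_mgf a (\<beta> * r)) \<le> Phi CARD('n) \<beta> b"
    and "b > 0 \<Longrightarrow> \<beta> * r \<noteq> b \<Longrightarrow> Phi CARD('n) \<beta> 0 + (\<beta> / 2 * r\<^sup>2 - log_mgf a (\<beta> * r)) < Phi CARD('n) \<beta> b"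
proof -
  have Phi: "Phi CARD('n) \<beta> b = Phi CARD('n) \<beta> 0 + b * r - log_mgf a b - \<beta> / 2 * r\<^sup>2"
    using Phi_eq[OF N b, of \<beta>] by (simp add: r_def a_def log_mgf_def)
  show "Phi CARD('n) \<beta> 0 + (\<beta> / 2 * r\<^sup>2 - log_mgf a (\<beta> * r)) \<le> Phi CARD('n) \<beta> b"
    using log_mgf_above_tangent[OF N, of b "\<beta> * r"] unfolding Phi a_def[symmetric] r_def[symmetric]
    by (simp add: algebra_simps power2_eq_square)
  show "Phi CARD('n) \<beta> 0 + (\<beta> / 2 * r\<^sup>2 - log_mgf a (\<beta> * r)) < Phi CARD('n) \<beta> b" if "b > 0" "\<beta> * r \<noteq> b"
    using log_mgf_above_tangent_strict[OF N that] unfolding Phi a_def[symmetric] r_def[symmetric]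
    by (simp add: algebra_simps power2_eq_square)
qed

section \<open>Minimizers\<close>

text \<open>\<open>log_mgf\<close> is at most \<open>(\<beta> * \<rho>)\<^sup>2 / (2 * N)\<close>
  with \<open>N = CARD('n)\<close>, and \<open>\<beta> \<le> N\<close> bounds this by
  \<open>\<beta> / 2 * \<rho>\<^sup>2\<close>. The first estimate is strict unless
  \<open>\<beta> * \<rho> = 0\<close>.\<close>

lemma subcritical_bound:
  assumes N: "CARD('n::finite) \<ge> 2" and \<beta>: "0 \<le> \<beta>" "\<beta> \<le> real CARD('n)" and \<rho>: "\<rho> \<ge> 0"
  shows "\<beta> / 2 * \<rho>\<^sup>2 - log_mgf (real CARD('n) / 2) (\<beta> * \<rho>) \<ge> 0"
    and "\<beta> / 2 * \<rho>\<^sup>2 - log_mgf (real CARD('n) / 2) (\<beta> * \<rho>) = 0 \<Longrightarrow> \<beta> * \<rho> = 0"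
proof -
  let ?a = "real CARD('n) / 2"
  have a: "?a \<ge> 1" using N by simp
  have "\<beta> * (\<beta> * \<rho>\<^sup>2) \<le> real CARD('n) * (\<beta> * \<rho>\<^sup>2)"
    using \<beta> by (intro mult_right_mono) auto
  then have le: "(\<beta> * \<rho>)\<^sup>2 / (4 * ?a) \<le> \<beta> / 2 * \<rho>\<^sup>2"
    by (simp add: field_simps power2_eq_square)
  show "\<beta> / 2 * \<rho>\<^sup>2 - log_mgf ?a (\<beta> * \<rho>) \<ge> 0"
    using log_mgf_le_quadratic[OF a, of "\<beta> * \<rho>"] le \<beta> \<rho> by simp
  show "\<beta> * \<rho> = 0" if "\<beta> / 2 * \<rho>\<^sup>2 - log_mgf ?a (\<beta> * \<rho>) = 0"
  proof (rule ccontr)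
    assume "\<beta> * \<rho> \<noteq> 0"
    then have "\<beta> * \<rho> > 0" using \<beta> \<rho> by (simp add: less_le)
    from log_mgf_less_quadratic[OF a this] le that show False by simp
  qed
qed

lemma macrostates_subcritical:
  assumes N: "CARD('n::finite) \<ge> 2" and \<beta>: "0 \<le> \<beta>" "\<beta> \<le> real CARD('n)"
  shows "macrostates \<beta> = {unif_sphere :: (real ^ 'n) measure}"
proof -
  obtain x :: "real ^ 'n" where x: "norm x = 1" by (rule obtain_unit_vector)
  \<comment> \<open>The uniform measure is the tilted measure with parameter 0, where the upper
    bound is 0.\<close>
  have le0: "free_energy \<beta> (unif_sphere :: (real ^ 'n) measure) \<le> 0"
    using free_energy_tilt_le[OF N \<beta>(1) x, of 0] by (simp add: tilt_0 zero_ereal_def)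
  have ge0: "0 \<le> free_energy \<beta> \<nu>" if "prob_on_sphere \<nu>" for \<nu> :: "(real ^ 'n) measure"
  proof -
    let ?m = "\<integral>z. z \<partial>\<nu>"
    have "0 \<le> ereal (\<beta> / 2 * (norm ?m)\<^sup>2 - log_mgf (real CARD('n) / 2) (\<beta> * norm ?m))"
      using subcritical_bound(1)[OF N \<beta>, of "norm ?m"] by simp
    then show ?thesis using free_energy_ge(1)[OF N \<beta>(1) that] by (rule order_trans)
  qed
  have "\<nu> = unif_sphere" if "\<nu> \<in> macrostates \<beta>" for \<nu> :: "(real ^ 'n) measure"
  proof -
    let ?m = "\<integral>z. z \<partial>\<nu>"
    have \<nu>: "prob_on_sphere \<nu>" and "free_energy \<beta> \<nu> \<le> free_energy \<beta> (unif_sphere :: (real ^ 'n) measure)"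
      using that prob_on_sphere_unif[where 'n = 'n] by (auto simp: macrostates_def)
    then have le: "free_energy \<beta> \<nu> \<le> 0" using le0 by (auto intro: order_trans)
    let ?K = "\<beta> / 2 * (norm ?m)\<^sup>2 - log_mgf (real CARD('n) / 2) (\<beta> * norm ?m)"
    have "ereal ?K \<le> 0" using order_trans[OF free_energy_ge(1)[OF N \<beta>(1) \<nu>] le] .
    moreover have "?K \<ge> 0" by (rule subcritical_bound(1)[OF N \<beta>]) simp
    ultimately have K: "?K = 0" by simp
    then have "\<nu> = tilt (\<beta> *\<^sub>R ?m)"
      using le by (intro free_energy_ge(2)[OF N \<beta>(1) \<nu>]) (simp only: K zero_ereal_def)
    \<comment> \<open>The product vanishes, not necessarily the mean by this argument; this is
      enough and includes \<open>\<beta> = 0\<close>.\<close>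
    moreover have "\<beta> * norm ?m = 0" by (rule subcritical_bound(2)[OF N \<beta> _ K]) simp
    then have "\<beta> *\<^sub>R ?m = 0" by auto
    ultimately show ?thesis by (simp add: tilt_0)
  qed
  moreover have "(unif_sphere :: (real ^ 'n) measure) \<in> macrostates \<beta>"
    using order_trans[OF le0 ge0] by (auto simp: macrostates_def prob_on_sphere_unif)
  ultimately show ?thesis by auto
qed

lemma bessel_fixed_point_iff:
  assumes "N \<ge> 2" "\<beta> > 0" "b > 0"
  shows "b = \<beta> * besselI (real N / 2) b / besselI (real N / 2 - 1) b
    \<longleftrightarrow> bessel_quot (real N / 2) b = 1 / \<beta>"
proof -
  have "\<beta> * besselI (real N / 2) b / besselI (real N / 2 - 1) b = \<beta> * (b * bessel_quot (real N / 2) b)"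
    using besselI_quotient[of "real N / 2" b] assms by (simp flip: times_divide_eq_right)
  then show ?thesis using assms by (auto simp: field_simps)
qed

lemma bessel_quot_inj:
  assumes "a \<ge> 1" "b \<ge> 0" "b' \<ge> 0" "bessel_quot a b = bessel_quot a b'"
  shows "b = b'"
  using bessel_quot_strict_decreasing[of a b b'] bessel_quot_strict_decreasing[of a b' b] assms
  by (cases b b' rule: linorder_cases) auto

text \<open>The quotient starts at \<open>1 / N > 1 / \<beta>\<close>, with
  \<open>N = CARD('n)\<close>, and is at most \<open>1 / \<beta>\<close> at
  \<open>b = \<beta>\<close>. Continuity gives a crossing, strict decrease its uniqueness.\<close>

lemma ex1_bessel_fixed_point:
  assumes N: "CARD('n::finite) \<ge> 2" and \<beta>: "\<beta> > real CARD('n)"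
  shows "\<exists>!b. b > 0 \<and> b = \<beta> * besselI (real CARD('n) / 2) b / besselI (real CARD('n) / 2 - 1) b"
proof -
  let ?q = "bessel_quot (real CARD('n) / 2)"
  have a: "real CARD('n) / 2 \<ge> 1" using N by simp
  have \<beta>0: "\<beta> > 0" using \<beta> N by simp
  have q0: "?q 0 > 1 / \<beta>" using \<beta> N by (simp add: bessel_quot_0[OF a] frac_less2)
  have "?q \<beta> \<le> 1 / \<beta>" using bessel_quot_le[OF N \<beta>0] .
  then obtain b where b: "b \<ge> 0" "?q b = 1 / \<beta>"
    using IVT2[of ?q \<beta> "1 / \<beta>" 0] q0 \<beta>0 isCont_bessel_quot[OF a] by auto
  then have "b > 0" using q0 by (cases "b = 0") auto
  with b show ?thesis
    using bessel_fixed_point_iff[OF N \<beta>0] bessel_quot_inj[OF a]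
    by (intro ex1I[of _ b]) (auto simp: less_imp_le)
qed

lemma
  assumes N: "CARD('n::finite) \<ge> 2" and \<beta>: "\<beta> > real CARD('n)"
  shows bstar_pos: "bstar CARD('n) \<beta> > 0"
    and bessel_quot_bstar: "bessel_quot (real CARD('n) / 2) (bstar CARD('n) \<beta>) = 1 / \<beta>"
proof -
  from theI'[OF ex1_bessel_fixed_point[OF assms]]
  have *: "bstar CARD('n) \<beta> > 0"
    "bstar CARD('n) \<beta> = \<beta> * besselI (real CARD('n) / 2) (bstar CARD('n) \<beta>)
        / besselI (real CARD('n) / 2 - 1) (bstar CARD('n) \<beta>)"
    unfolding bstar_def[symmetric] by auto
  show "bstar CARD('n) \<beta> > 0" by fact
  show "bessel_quot (real CARD('n) / 2) (bstar CARD('n) \<beta>) = 1 / \<beta>"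
    using bessel_fixed_point_iff[OF N _ *(1), of \<beta>] *(2) \<beta> by simp
qed

text \<open>In the variable \<open>t = \<beta> * \<rho>\<close> the right side is
  \<open>t\<^sup>2 / (2 * \<beta>) - log_mgf a t\<close>, which \<open>log_mgf_tilted_min\<close>
  minimizes with \<open>b0 = b\<close>.\<close>

lemma supercritical_bound:
  assumes N: "CARD('n::finite) \<ge> 2" and \<beta>: "\<beta> > real CARD('n)" and \<rho>: "\<rho> \<ge> 0"
  defines "b \<equiv> bstar CARD('n) \<beta>" and "a \<equiv> real CARD('n) / 2"
  shows "b\<^sup>2 / (2 * \<beta>) - log_mgf a b \<le> \<beta> / 2 * \<rho>\<^sup>2 - log_mgf a (\<beta> * \<rho>)"
    and "\<beta> / 2 * \<rho>\<^sup>2 - log_mgf a (\<beta> * \<rho>) \<le> b\<^sup>2 / (2 * \<beta>) - log_mgf a b \<Longrightarrow> \<beta> * \<rho> = b"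
proof -
  have a: "a \<ge> 1" using N by (simp add: a_def)
  have \<beta>0: "\<beta> > 0" using \<beta> N by simp
  have eq: "(\<beta> * \<rho>)\<^sup>2 / (2 * \<beta>) = \<beta> / 2 * \<rho>\<^sup>2" using \<beta>0 by (simp add: power2_eq_square)
  have lt: "b\<^sup>2 / (2 * \<beta>) - log_mgf a b < \<beta> / 2 * \<rho>\<^sup>2 - log_mgf a (\<beta> * \<rho>)" if "\<beta> * \<rho> \<noteq> b"
    unfolding eq[symmetric] using bstar_pos[OF N \<beta>] bessel_quot_bstar[OF N \<beta>] \<beta>0 \<rho> that
    by (intro log_mgf_tilted_min a) (auto simp: a_def b_def)
  then show "b\<^sup>2 / (2 * \<beta>) - log_mgf a b \<le> \<beta> / 2 * \<rho>\<^sup>2 - log_mgf a (\<beta> * \<rho>)"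
    using eq by (cases "\<beta> * \<rho> = b") auto
  show "\<beta> / 2 * \<rho>\<^sup>2 - log_mgf a (\<beta> * \<rho>) \<le> b\<^sup>2 / (2 * \<beta>) - log_mgf a b \<Longrightarrow> \<beta> * \<rho> = b"
    using lt by fastforce
qed

text \<open>At the fixed point \<open>\<beta> * r = b\<close>, so the tangent bound in
  \<open>Phi_ge\<close> is an equality.\<close>

lemma Phi_bstar:
  assumes N: "CARD('n::finite) \<ge> 2" and \<beta>: "\<beta> > real CARD('n)"
  defines "b \<equiv> bstar CARD('n) \<beta>"
  shows "Phi CARD('n) \<beta> b = Phi CARD('n) \<beta> 0 + (b\<^sup>2 / (2 * \<beta>) - log_mgf (real CARD('n) / 2) b)"
proof -
  have b: "b \<ge> 0" and q: "bessel_quot (real CARD('n) / 2) b = 1 / \<beta>"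
    unfolding b_def by (rule less_imp_le[OF bstar_pos[OF N \<beta>]], rule bessel_quot_bstar[OF N \<beta>])
  have "\<beta> > 0" using \<beta> N by simp
  then have "b * (b * (1 / \<beta>)) - \<beta> / 2 * (b * (1 / \<beta>))\<^sup>2 = b\<^sup>2 / (2 * \<beta>)"
    by (simp add: field_simps power2_eq_square)
  then show ?thesis
    using Phi_eq[OF N b, of \<beta>, unfolded q] unfolding log_mgf_def by linarith
qed

lemma Phi_minimizers_supercritical:
  assumes N: "CARD('n::finite) \<ge> 2" and \<beta>: "\<beta> > real CARD('n)"
  shows "{b. b \<ge> 0 \<and> (\<forall>b'\<ge>0. Phi CARD('n) \<beta> b \<le> Phi CARD('n) \<beta> b')} = {bstar CARD('n) \<beta>}"
proof -
  let ?a = "real CARD('n) / 2" and ?s = "bstar CARD('n) \<beta>"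
  have a: "?a \<ge> 1" using N by simp
  have s: "?s > 0" by (rule bstar_pos[OF N \<beta>])
  have min: "Phi CARD('n) \<beta> ?s \<le> Phi CARD('n) \<beta> b" and uniq: "Phi CARD('n) \<beta> b \<le> Phi CARD('n) \<beta> ?s \<Longrightarrow> b = ?s"
    if b: "b \<ge> 0" for b
  proof -
    let ?r = "b * bessel_quot ?a b"
    let ?K = "\<beta> / 2 * ?r\<^sup>2 - log_mgf ?a (\<beta> * ?r)" and ?G = "?s\<^sup>2 / (2 * \<beta>) - log_mgf ?a ?s"
    have r: "?r \<ge> 0" using b bessel_quot_pos[OF a, of b] by simp
    have K: "?G \<le> ?K" by (rule supercritical_bound(1)[OF N \<beta> r])
    then show "Phi CARD('n) \<beta> ?s \<le> Phi CARD('n) \<beta> b"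
      using Phi_ge(1)[OF N b, of \<beta>] Phi_bstar[OF N \<beta>] by linarith
    assume le: "Phi CARD('n) \<beta> b \<le> Phi CARD('n) \<beta> ?s"
    then have "?K \<le> ?G"
      using Phi_ge(1)[OF N b, of \<beta>] Phi_bstar[OF N \<beta>] by linarith
    then have s_eq: "\<beta> * ?r = ?s" by (rule supercritical_bound(2)[OF N \<beta> r])
    \<comment> \<open>So far only \<open>\<beta> * ?r = ?s\<close> is known; for
      \<open>b > 0\<close> the strict tangent bound adds \<open>\<beta> * ?r = b\<close>.\<close>
    have "b > 0" using s_eq s b by (cases "b = 0") auto
    then show "b = ?s"
      using Phi_ge(2)[OF N b, of \<beta>] Phi_bstar[OF N \<beta>] le K s_eq by (cases "\<beta> * ?r = b") auto
  qed
  show ?thesis using s min uniq by (auto simp: less_imp_le)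
qed

text \<open>Upper and lower bounds meet, so the tilts of strength \<open>bstar\<close> minimize in
  every direction. Conversely, equality in the lower bounds first fixes the norm of the mean and
  then the measure.\<close>

lemma macrostates_supercritical:
  assumes N: "CARD('n::finite) \<ge> 2" and \<beta>: "\<beta> > real CARD('n)"
  shows "macrostates \<beta> = {vmf (bstar CARD('n) \<beta>) x | x :: real ^ 'n. x \<in> sphere 0 1}"
proof -
  let ?a = "real CARD('n) / 2" and ?s = "bstar CARD('n) \<beta>"
  let ?G = "?s\<^sup>2 / (2 * \<beta>) - log_mgf ?a ?s"
  have \<beta>0: "\<beta> \<ge> 0" "\<beta> > 0" using \<beta> N by simp_all
  have s: "?s > 0" by (rule bstar_pos[OF N \<beta>])
  have q: "bessel_quot ?a ?s = 1 / \<beta>" by (rule bessel_quot_bstar[OF N \<beta>])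
  have lower: "ereal ?G \<le> free_energy \<beta> \<nu>" if "prob_on_sphere \<nu>" for \<nu> :: "(real ^ 'n) measure"
    by (rule order_trans[OF _ free_energy_ge(1)[OF N \<beta>0(1) that]])
       (use supercritical_bound(1)[OF N \<beta>] in simp)
  have upper: "free_energy \<beta> (tilt (?s *\<^sub>R x)) \<le> ereal ?G" if "norm x = 1" for x :: "real ^ 'n"
  proof -
    have eq: "?s * (?s * (1 / \<beta>)) - log_mgf ?a ?s - \<beta> / 2 * (?s * (1 / \<beta>))\<^sup>2 = ?G"
      using \<beta>0 by (simp add: field_simps power2_eq_square)
    show ?thesis
      using free_energy_tilt_le[OF N \<beta>0(1) that less_imp_le[OF s]] unfolding q eq .
  qed
  have "vmf ?s x \<in> macrostates \<beta>" if "norm x = 1" for x :: "real ^ 'n"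
    unfolding vmf_eq_tilt[OF N that]
    using order_trans[OF upper[OF that] lower] prob_on_sphere_tilt[OF N] by (simp add: macrostates_def)
  moreover have "\<exists>x. norm x = 1 \<and> \<nu> = vmf ?s x" if "\<nu> \<in> macrostates \<beta>" for \<nu> :: "(real ^ 'n) measure"
  proof -
    let ?m = "\<integral>z. z \<partial>\<nu>"
    let ?K = "\<beta> / 2 * (norm ?m)\<^sup>2 - log_mgf ?a (\<beta> * norm ?m)"
    obtain x :: "real ^ 'n" where x: "norm x = 1" by (rule obtain_unit_vector)
    have \<nu>: "prob_on_sphere \<nu>" and "free_energy \<beta> \<nu> \<le> free_energy \<beta> (tilt (?s *\<^sub>R x))"
      using that prob_on_sphere_tilt[OF N] by (auto simp: macrostates_def)
    then have le: "free_energy \<beta> \<nu> \<le> ereal ?G" using upper[OF x] by (auto intro: order_trans)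
    then have "?K \<le> ?G" using order_trans[OF free_energy_ge(1)[OF N \<beta>0(1) \<nu>] le] by simp
    then have m: "\<beta> * norm ?m = ?s" by (rule supercritical_bound(2)[OF N \<beta> norm_ge_zero])
    have "ereal ?G \<le> ereal ?K" using supercritical_bound(1)[OF N \<beta>, of "norm ?m"] by simp
    with le have "free_energy \<beta> \<nu> \<le> ereal ?K" by (rule order_trans)
    then have "\<nu> = tilt (\<beta> *\<^sub>R ?m)" by (rule free_energy_ge(2)[OF N \<beta>0(1) \<nu>])
    \<comment> \<open>The unit vector sought is the direction of the mean.\<close>
    moreover have "?m \<noteq> 0" using m s by auto
    then have "norm (?m /\<^sub>R norm ?m) = 1" "\<beta> *\<^sub>R ?m = ?s *\<^sub>R (?m /\<^sub>R norm ?m)"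
      by (auto simp: m[symmetric])
    ultimately show ?thesis using vmf_eq_tilt[OF N] by metis
  qed
  ultimately show ?thesis by auto
qed

text \<open>If \<open>N < \<beta> < 1 / bessel_quot a e\<close> for \<open>N = CARD('n)\<close>, the
  quotient at \<open>e\<close> is below \<open>1 / \<beta>\<close>, its value at
  \<open>bstar\<close>, hence \<open>bstar < e\<close>. Such \<open>\<beta>\<close> exist because
  the quotient at \<open>e\<close> is below \<open>1 / N\<close>.\<close>

lemma bstar_tendsto_0:
  assumes N: "CARD('n::finite) \<ge> 2"
  shows "(bstar CARD('n) \<longlongrightarrow> 0) (at_right (real CARD('n)))"
proof (rule tendstoI)
  fix e :: real assume e: "e > 0"
  let ?a = "real CARD('n) / 2"
  have a: "?a \<ge> 1" using N by simp
  have "bessel_quot ?a e < 1 / real CARD('n)"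
    using bessel_quot_strict_decreasing[OF a, of 0 e] e by (simp add: bessel_quot_0[OF a])
  then have lt: "real CARD('n) < 1 / bessel_quot ?a e"
    using bessel_quot_pos[OF a, of e] N by (simp add: field_simps)
  have "dist (bstar CARD('n) \<beta>) 0 < e" if "real CARD('n) < \<beta>" "\<beta> < 1 / bessel_quot ?a e" for \<beta>
  proof -
    have "bessel_quot ?a e < 1 / \<beta>"
      using that bessel_quot_pos[OF a, of e] N by (simp add: field_simps)
    then have "bessel_quot ?a e < bessel_quot ?a (bstar CARD('n) \<beta>)"
      using bessel_quot_bstar[OF N that(1)] by simp
    then have "bstar CARD('n) \<beta> < e"
      using bessel_quot_strict_decreasing[OF a, of e "bstar CARD('n) \<beta>"] e
      by (cases e "bstar CARD('n) \<beta>" rule: linorder_cases) auto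
    then show ?thesis using bstar_pos[OF N that(1)] by simp
  qed
  then show "\<forall>\<^sub>F \<beta> in at_right (real CARD('n)). dist (bstar CARD('n) \<beta>) 0 < e"
    using lt by (auto simp: eventually_at_right)
qed

theorem theorem2p7:
  fixes \<beta> :: real
  assumes "CARD('n) \<ge> 2" and "\<beta> \<ge> 0"
  shows "(\<beta> \<le> real CARD('n) \<longrightarrow>
            (\<forall>b\<ge>0. Phi CARD('n) \<beta> 0 \<le> Phi CARD('n) \<beta> b) \<and>
            macrostates \<beta> = {unif_sphere :: (real ^ 'n) measure})
       \<and> (\<beta> > real CARD('n) \<longrightarrow>
            (\<exists>!b. b > 0 \<and> b = \<beta> * besselI (real CARD('n) / 2) b / besselI (real CARD('n) / 2 - 1) b) \<and>
            {b. b \<ge> 0 \<and> (\<forall>b'\<ge>0. Phi CARD('n) \<beta> b \<le> Phi CARD('n) \<beta> b')} = {bstar CARD('n) \<beta>} \<and>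
            macrostates \<beta> = {vmf (bstar CARD('n) \<beta>) x | x :: real ^ 'n. x \<in> sphere 0 1})
       \<and> ((bstar CARD('n) \<longlongrightarrow> 0) (at_right (real CARD('n))))"
proof -
  note N = assms(1)
  \<comment> \<open>The excess over \<open>Phi CARD('n) \<beta> 0\<close> in \<open>Phi_ge\<close>
    is nonnegative by the subcritical bound.\<close>
  have Phi0: "Phi CARD('n) \<beta> 0 \<le> Phi CARD('n) \<beta> b" if "\<beta> \<le> real CARD('n)" "b \<ge> 0" for b
  proof -
    have a: "real CARD('n) / 2 \<ge> 1" using N by simp
    have "b * bessel_quot (real CARD('n) / 2) b \<ge> 0"
      using that bessel_quot_pos[OF a, of b] by simp
    from subcritical_bound(1)[OF N assms(2) that(1) this] Phi_ge(1)[OF N that(2), of \<beta>]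
    show ?thesis by linarith
  qed
  show ?thesis
    by (intro conjI impI allI Phi0 macrostates_subcritical[OF N assms(2)] ex1_bessel_fixed_point[OF N]
        Phi_minimizers_supercritical[OF N] macrostates_supercritical[OF N] bstar_tendsto_0[OF N])
qed

end
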